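(* Let $(\Omega,m,\theta,\alpha)$ be a conservative and ergodic Markov fibred system with respect to a finite partition $\alpha$ of $\Omega$, let $B\subset\Omega$ be measurable with respect to the $\sigma$-algebra generated by $\alpha^n=\bigvee_{k=0}^{n-1}\theta^{-k}(\alpha)$ for some $n\in\mathbb{N}$, and let $(B,\widetilde m,\widetilde\theta,\widetilde\alpha)$ be the induced system. Let $\widetilde\nu$ be a $\widetilde\theta$-invariant measure which is absolutely continuous with respect to $\widetilde m$ and satisfies $\widetilde\nu(N)<\infty$, and let $\nu$ be the $\theta$-invariant probability measure obtained through Kac's formula $$\int f\,d\nu=\frac{1}{\widetilde\nu(N)}\int_B\sum_{k=0}^{N(\omega)-1}f\circ\theta^k(\omega)\,d\widetilde\nu(\omega).$$ Then the following holds. (1) For $\nu$-almost all $\omega\in B$, $$\frac{d\nu\circ\theta}{d\nu}(\omega)=\left(\sum_{a\in\mathcal{Z}(\theta\omega)}\frac{d\widetilde\nu\circ\widetilde\tau_a}{d\widetilde\nu}\big(\theta^{N(\omega)}(\omega)\big)\right)\cdot\frac{d\widetilde\nu\circ\widetilde\theta}{d\widetilde\nu}(\omega).$$ (2) For $\nu$-almost all $\omega\in\Omega\setminus B$, $$\frac{d\nu\circ\theta}{d\nu}(\omega)=\left(\sum_{a\in\mathcal{Z}(\theta\omega)}\frac{d\widetilde\nu\circ\widetilde\tau_a}{d\widetilde\nu}\big(\theta^{N(\omega)}(\omega)\big)\right)\Big/\left(\sum_{a\in\mathcal{Z}(\omega)}\frac{d\widetilde\nu\circ\widetilde\tau_a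}{d\widetilde\nu}\big(\theta^{N(\omega)}(\omega)\big)\right).$$
   Context: Markov fibred system: $\Omega$ is a Polish space, $m$ a finite Borel measure on $\Omega$, $\theta:\Omega\to\Omega$ a locally invertible non-singular transformation, and $\alpha$ a countable partition of $\Omega$ (Markov partition) such that $\theta:a\to\theta(a)$ is invertible for all $a\in\alpha$, $\theta(a)$ lies in the $\sigma$-algebra generated by $\alpha$ for all $a\in\alpha$, and the $\sigma$-algebra generated by $\{\alpha^n\mid n\in\mathbb{N}\}$ is the Borel $\sigma$-algebra of $\Omega$ up to sets of measure zero. The restriction of $\theta^n$ to any $a\in\alpha^n$ is invertible and non-singular onto its image. It is assumed throughout that $\frac{dm\circ\theta}{dm}$ has a continuous version on the support of $m$. Derivatives such as $\frac{d\nu\circ\theta}{d\nu}$ are computed on each partition element, where the map is injective. Induced system: $N:\Omega\to\mathbb{N}\cup\{\infty\}$, $N(\omega):=\inf\{n\in\mathbb{N}\mid\theta^n(\omega)\in B\}$ (with $n\ge1$); $\widetilde\theta:B\to B$, $\widetilde\theta(\omega):=\theta^{N(\omega)}(\omega)$; $\widetilde m:=m|_B$; $\widetilde\alpha$ is the associated countable partition of $B$, with respect to which $(B,\widetilde m,\widetilde\theta,\widetilde\alpha)$ is again a conservative ergodic Markov fibred system and on each element of which $N$ is constant. $\widetilde\tau_a$ denotes the inverse branch of $\widetilde\theta|_a$, $a\in\widetilde\alpha$. $\widetilde\nu(N):=\int_BN\,d\widetilde\nu$. Notation $\mathcal{Z}$: let $D_n:=\{\omega\in\Omega\mid N(\omega)=n\}$,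 and put $N(A):=n$ if $A\subset D_n$. For $A\subset D_n$ such that, for some $b\in\widetilde\alpha$, either $A\subset B\cap b$, or $A\subset\Omega\setminus B$ and $\theta^n(A)\subset b$, define $$\mathcal{Z}(A):=\begin{cases}\{a\in\widetilde\alpha\mid A\subset\theta^{N(a)}(a)\}, & A\subset B,\\ \{a\in\widetilde\alpha\mid N(a)>N(A),\ A\subset\theta^{N(a)-N(A)}(a)\}, & A\subset\Omega\setminus B.\end{cases}$$ Put $\mathcal{Z}(\omega):=\mathcal{Z}(b)$ if either $\omega\in b\in\widetilde\alpha$, or $\omega\in\Omega\setminus B$ and $\omega\in b\in\alpha^n$ where $\theta^n(b)\in\widetilde\alpha$ for some $n\in\mathbb{N}$. Thus for $\omega\in B$ the set $\{\widetilde\tau_a\mid a\in\mathcal{Z}(\omega)\}$ consists of the inverse branches of $\widetilde\theta$ at $\omega$; for $\omega\notin B$ it consists of the inverse branches of $\widetilde\theta$ at $\theta^{N(\omega)}(\omega)$ whose forward $\theta$-orbit passes through $\omega$ before returning to $B$, i.e. $\{\widetilde\tau_a(\theta^{N(\omega)}(\omega))\mid a\in\mathcal{Z}(\omega)\}=\bigcup_{l=N(\omega)+1}^\infty\theta^{-(l-N(\omega))}(\omega)\cap D_l\cap B$. *)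

theory Defs
  imports "HOL-Probability.Probability"
begin

section \<open>Derivatives of locally invertible maps\<close>

text \<open>
  For \<open>T\<close> injective on \<open>a\<close>, with measurable images of measurable subsets of \<open>a\<close>, this is the
  measure \<open>A \<mapsto> \<mu> (T A)\<close> on the measurable subsets \<open>A\<close> of \<open>a\<close>.
\<close>
definition comp_measure :: "'a measure \<Rightarrow> ('a \<Rightarrow> 'a) \<Rightarrow> 'a set \<Rightarrow> 'a measure" where
  "comp_measure \<mu> T a = measure_of a {A \<in> sets \<mu>. A \<subseteq> a} (\<lambda>A. emeasure \<mu> (T ` A))"

text \<open>The derivative \<open>d(\<mu> \<circ> T) / d\<mu>\<close> on a set \<open>a\<close> on which \<open>T\<close> is injective.\<close>
definition deriv_on :: "'a measure \<Rightarrow> ('a \<Rightarrow> 'a) \<Rightarrow> 'a set \<Rightarrow> 'a \<Rightarrow> ennreal" where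
  "deriv_on \<mu> T a = RN_deriv (restrict_space \<mu> a) (comp_measure \<mu> T a)"

text \<open>
  The derivative \<open>d(\<mu> \<circ> T) / d\<mu>\<close> computed on each element of \<open>P\<close>, for a disjoint family \<open>P\<close>.
  Points outside \<open>\<Union>P\<close> get an unspecified value; below they form a null set.
\<close>
definition measure_jacobian :: "'a measure \<Rightarrow> 'a set set \<Rightarrow> ('a \<Rightarrow> 'a) \<Rightarrow> 'a \<Rightarrow> ennreal" where
  "measure_jacobian \<mu> P T \<omega> = deriv_on \<mu> T (THE a. a \<in> P \<and> \<omega> \<in> a) \<omega>"


section \<open>Markov fibred systems\<close>

text \<open>
  The partition \<open>\<alpha>\<^sup>n\<close>, the join of \<open>\<theta>\<^sup>-\<^sup>k \<alpha>\<close> over \<open>k < n\<close>; \<open>cylinders \<theta> \<alpha> 0\<close> is the trivial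
  partition.
\<close>
definition cylinders :: "('a \<Rightarrow> 'a) \<Rightarrow> 'a set set \<Rightarrow> nat \<Rightarrow> 'a set set" where
  "cylinders \<theta> \<alpha> n = {\<Inter>k\<in>{..<n}. (\<theta> ^^ k) -` s k | s. \<forall>k<n. s k \<in> \<alpha>} - {{}}"

definition measure_support :: "'a::topological_space measure \<Rightarrow> 'a set" where
  "measure_support \<mu> = {x. \<forall>U. open U \<and> x \<in> U \<longrightarrow> 0 < emeasure \<mu> U}"

text \<open>
  Invertibility of \<open>\<theta> : a \<rightarrow> \<theta>(a)\<close> is meant in the measurable sense. For Borel maps on Polish
  spaces, \<open>image_measurable\<close> is automatic from injectivity (Lusin--Souslin).
\<close>
locale markov_fibred_system = finite_measure m
  for m :: "'a::polish_space measure" +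
  fixes \<theta> :: "'a \<Rightarrow> 'a" and \<alpha> :: "'a set set"
  assumes sets_m: "sets m = sets borel"
    and measurable_map: "\<theta> \<in> borel \<rightarrow>\<^sub>M borel"
    and nonsingular: "\<And>A. A \<in> sets borel \<Longrightarrow> emeasure m (\<theta> -` A) = 0 \<longleftrightarrow> emeasure m A = 0"
    and countable_partition: "countable \<alpha>"
    and partition: "partition_on UNIV \<alpha>"
    and partition_measurable: "\<alpha> \<subseteq> sets borel"
    and invertible: "\<And>a. a \<in> \<alpha> \<Longrightarrow> inj_on \<theta> a"
    and image_measurable:
      "\<And>a A. a \<in> \<alpha> \<Longrightarrow> A \<subseteq> a \<Longrightarrow> A \<in> sets borel \<Longrightarrow> \<theta> ` A \<in> sets borel"
    and branch_nonsingular: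
      "\<And>a A. a \<in> \<alpha> \<Longrightarrow> A \<subseteq> a \<Longrightarrow> A \<in> sets borel \<Longrightarrow>
         emeasure m (\<theta> ` A) = 0 \<longleftrightarrow> emeasure m A = 0"
    and markov: "\<And>a. a \<in> \<alpha> \<Longrightarrow> \<theta> ` a \<in> sigma_sets UNIV \<alpha>"
    and generating:
      "\<And>A. A \<in> sets borel \<Longrightarrow>
         \<exists>A' \<in> sigma_sets UNIV (\<Union>n. cylinders \<theta> \<alpha> n). emeasure m ((A - A') \<union> (A' - A)) = 0"
    and continuous_derivative:
      "\<exists>g :: 'a \<Rightarrow> real. continuous_on (measure_support m) g \<and>
         (AE \<omega> in m. measure_jacobian m \<alpha> \<theta> \<omega> = ennreal (g \<omega>))"

definition conservative :: "'a measure \<Rightarrow> ('a \<Rightarrow> 'a) \<Rightarrow> bool" where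
  "conservative \<mu> T \<longleftrightarrow>
     (\<forall>W \<in> sets \<mu>. disjoint_family (\<lambda>k. (T ^^ k) -` W \<inter> space \<mu>) \<longrightarrow> emeasure \<mu> W = 0)"

definition ergodic :: "'a measure \<Rightarrow> ('a \<Rightarrow> 'a) \<Rightarrow> bool" where
  "ergodic \<mu> T \<longleftrightarrow>
     (\<forall>A \<in> sets \<mu>. T -` A \<inter> space \<mu> = A \<longrightarrow> emeasure \<mu> A = 0 \<or> emeasure \<mu> (space \<mu> - A) = 0)"

definition invariant_measure :: "'a measure \<Rightarrow> ('a \<Rightarrow> 'a) \<Rightarrow> bool" where
  "invariant_measure \<mu> T \<longleftrightarrow> T \<in> \<mu> \<rightarrow>\<^sub>M \<mu> \<and> distr \<mu> \<mu> T = \<mu>"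


section \<open>The induced system\<close>

definition hit_time :: "('a \<Rightarrow> 'a) \<Rightarrow> 'a set \<Rightarrow> 'a \<Rightarrow> enat" where
  "hit_time \<theta> B \<omega> = (INF n\<in>{n. 1 \<le> n \<and> (\<theta> ^^ n) \<omega> \<in> B}. enat n)"

definition hit_set :: "('a \<Rightarrow> 'a) \<Rightarrow> 'a set \<Rightarrow> nat \<Rightarrow> 'a set" where
  "hit_set \<theta> B n = {\<omega>. hit_time \<theta> B \<omega> = enat n}"

text \<open>
  \<open>\<omega> \<mapsto> \<theta>\<^sup>N\<^sup>(\<^sup>\<omega>\<^sup>)(\<omega>)\<close> on all of \<open>\<Omega>\<close>; its restriction to \<open>B\<close> is the induced map. Points with
  \<open>N(\<omega>) = \<infinity>\<close>, which form a null set, are sent to themselves.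
\<close>
definition hit_map :: "('a \<Rightarrow> 'a) \<Rightarrow> 'a set \<Rightarrow> 'a \<Rightarrow> 'a" where
  "hit_map \<theta> B \<omega> = (case hit_time \<theta> B \<omega> of enat n \<Rightarrow> (\<theta> ^^ n) \<omega> | \<infinity> \<Rightarrow> \<omega>)"

text \<open>
  For \<open>B\<close> measurable with respect to \<open>\<sigma>(\<alpha>\<^sup>n)\<close>, the set \<open>B \<inter> {N = k}\<close> is a union of elements of
  \<open>\<alpha>\<^sup>n\<^sup>+\<^sup>k\<close>. The induced partition consists of these elements, for all finite \<open>k\<close>; it covers \<open>B\<close>
  up to the null set \<open>B \<inter> {N = \<infinity>}\<close>.
\<close>
definition induced_partition ::
    "('a \<Rightarrow> 'a) \<Rightarrow> 'a set set \<Rightarrow> nat \<Rightarrow> 'a set \<Rightarrow> 'a set set" where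
  "induced_partition \<theta> \<alpha> n B = {a. \<exists>k. a \<in> cylinders \<theta> \<alpha> (n + k) \<and> a \<subseteq> B \<inter> hit_set \<theta> B k}"

text \<open>\<open>N(A)\<close> for a nonempty set \<open>A\<close> on which \<open>N\<close> is constant and finite.\<close>
definition set_hit_time :: "('a \<Rightarrow> 'a) \<Rightarrow> 'a set \<Rightarrow> 'a set \<Rightarrow> nat" where
  "set_hit_time \<theta> B A = (THE n. A \<subseteq> hit_set \<theta> B n)"

definition inverse_branch :: "('a \<Rightarrow> 'a) \<Rightarrow> 'a set \<Rightarrow> 'a set \<Rightarrow> 'a \<Rightarrow> 'a" where
  "inverse_branch \<theta> B a = the_inv_into a (hit_map \<theta> B)"

text \<open>\<open>d(\<nu>' \<circ> \<tau>\<^sub>a) / d\<nu>'\<close> on the domain of the inverse branch \<open>\<tau>\<^sub>a\<close> of the induced map.\<close>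
definition branch_deriv :: "'a measure \<Rightarrow> ('a \<Rightarrow> 'a) \<Rightarrow> 'a set \<Rightarrow> 'a set \<Rightarrow> 'a \<Rightarrow> ennreal" where
  "branch_deriv \<nu>' \<theta> B a = deriv_on \<nu>' (inverse_branch \<theta> B a) (hit_map \<theta> B ` a)"


section \<open>The index sets \<open>Z\<close>\<close>

text \<open>Here and below, \<open>\<alpha>'\<close> is the induced partition. Only used for \<open>A \<subseteq> B\<close> or \<open>A \<subseteq> - B\<close>.\<close>
definition Z_set :: "('a \<Rightarrow> 'a) \<Rightarrow> 'a set \<Rightarrow> 'a set set \<Rightarrow> 'a set \<Rightarrow> 'a set set" where
  "Z_set \<theta> B \<alpha>' A =
     (let N = set_hit_time \<theta> B in
      if A \<subseteq> B then {a \<in> \<alpha>'. A \<subseteq> (\<theta> ^^ N a) ` a}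
      else {a \<in> \<alpha>'. N a > N A \<and> A \<subseteq> (\<theta> ^^ (N a - N A)) ` a})"

text \<open>
  For \<open>\<omega>\<close> outside \<open>B\<close>, the set \<open>b\<close> is the cylinder about \<open>\<omega>\<close> which \<open>\<theta>\<^sup>n\<close>, with \<open>n = N(\<omega>)\<close>, maps
  bijectively onto an element of the induced partition. The latter is itself a cylinder, so the
  length \<open>l\<close> of \<open>b\<close> is in general larger than \<open>n\<close>; \<open>n \<le> l\<close> ensures that \<open>\<theta>\<^sup>n\<close> is injective
  on \<open>b\<close>, which makes \<open>b\<close> unique. Such a \<open>b\<close> exists for almost every \<open>\<omega>\<close>.
\<close>
definition Z_point ::
    "('a \<Rightarrow> 'a) \<Rightarrow> 'a set set \<Rightarrow> 'a set \<Rightarrow> 'a set set \<Rightarrow> 'a \<Rightarrow> 'a set set" where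
  "Z_point \<theta> \<alpha> B \<alpha>' \<omega> =
     Z_set \<theta> B \<alpha>'
       (if \<omega> \<in> B then (THE b. b \<in> \<alpha>' \<and> \<omega> \<in> b)
        else (THE b. \<omega> \<in> b \<and>
               (\<exists>n l. n \<le> l \<and> b \<in> cylinders \<theta> \<alpha> l \<and> b \<subseteq> hit_set \<theta> B n - B \<and> (\<theta> ^^ n) ` b \<in> \<alpha>')))"

end

(*
  On B the measure \<nu> is \<nu>' up to the constant \<nu>'(N), and conservativity and ergodicity make \<nu>
  equivalent to m, so all derivatives exist.  Let A lie in a cylinder on which the time k of entry
  into B is constant.  Cutting the Kac tower along the induced partition (and using the invariance
  of \<nu>' when k = 0) gives
    \<nu>(A) = sum over a in Z of \<nu>(\<tau>_a \<theta>^k A) = integral over \<theta>^k A of S,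
  where S is the sum over Z of the derivatives d(\<nu>' o \<tau>_a)/d\<nu>'.  Applied to A and to \<theta> A, which
  have the same image in B, this expresses \<nu>(\<theta> A) through \<nu>(A) by a change of variables along
  \<theta>^k; on B one substitutes \<nu>(\<theta>' A) = integral over A of d(\<nu>' o \<theta>')/d\<nu>' instead.
*)

theory Submission
  imports Defs
begin

section \<open>Integrals and derivatives\<close>

text \<open>Every identity is proved on one cylinder, where \<open>Z\<close>, the time
  \<open>k\<close> and the branch of \<open>\<theta>\<close> are constant, and is then glued over
  the countably many cylinders. The lengths are forced: a visit to \<open>B\<close> at time
  \<open>j\<close> is read off from the first \<open>n + j\<close> symbols, so \<open>n + k\<close>
  symbols fix a first visit at time \<open>k\<close>; and \<open>\<theta> ^^ j\<close> maps a
  cylinder onto the one with the first \<open>j\<close> symbols deleted provided that a symbol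
  remains, which \<open>1 \<le> n\<close> guarantees. The obstacle is that \<open>Z\<close> is given
  by two different inclusions of cylinders, inside and outside \<open>B\<close>, while the argument
  compares a point with its image, which may belong to the other case. Counting the time to
  \<open>B\<close> with 0 allowed merges the cases: \<open>Z\<close> becomes the set of induced
  cylinders whose orbits pass through the point with \<open>k\<close> steps left, and a point with
  hit time \<open>k + 1\<close> is sent to one with entry time \<open>k\<close>. Formula (2) divides
  by \<open>S\<close>, in \<open>ennreal\<close>, so \<open>S\<close> must be shown to be almost
  everywhere neither 0 nor infinite. Both facts come from the integral formula for \<open>S\<close>
  itself.\<close>

lemma infsum_eq_suminf:
  fixes f :: "'i \<Rightarrow> ennreal"
  assumes "countable A" "infinite A"
  shows "(\<Sum>\<^sub>\<infinity>i\<in>A. f i) = (\<Sum>j. f (from_nat_into A j))"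
proof -
  have "(\<Sum>\<^sub>\<infinity>i\<in>A. f i) = (\<Sum>\<^sub>\<infinity>j. f (from_nat_into A j))"
    using infsum_reindex_bij_betw[OF bij_betw_from_nat_into[OF assms]] by metis
  also have "\<dots> = (\<Sum>j. f (from_nat_into A j))"
    by (intro sums_unique has_sum_imp_sums has_sum_infsum nonneg_summable_on_complete) simp
  finally show ?thesis .
qed

text \<open>Writing the sum over \<open>Z\<close> as an integral over a counting measure makes
  Tonelli applicable to it.\<close>

lemma infsum_eq_nn_integral_count_space:
  fixes f :: "'i \<Rightarrow> ennreal"
  assumes "countable A"
  shows "(\<Sum>\<^sub>\<infinity>i\<in>A. f i) = (\<integral>\<^sup>+i. f i \<partial>count_space A)"
proof (cases "finite A")
  case False
  have "(\<Sum>\<^sub>\<infinity>i\<in>A. f i) = (\<integral>\<^sup>+j. f (from_nat_into A j) \<partial>count_space UNIV)"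
    using infsum_eq_suminf[OF assms False] by (simp add: nn_integral_count_space_nat)
  also have "\<dots> = (\<integral>\<^sup>+i. f i \<partial>count_space A)"
    by (rule nn_integral_bij_count_space[OF bij_betw_from_nat_into[OF assms False]])
  finally show ?thesis .
qed (simp add: nn_integral_count_space_finite)

lemma borel_measurable_infsum_ennreal:
  fixes f :: "'i \<Rightarrow> 'a \<Rightarrow> ennreal"
  assumes "countable A" "\<And>i. i \<in> A \<Longrightarrow> f i \<in> borel_measurable M"
  shows "(\<lambda>x. \<Sum>\<^sub>\<infinity>i\<in>A. f i x) \<in> borel_measurable M"
proof (cases "finite A")
  case False
  have "f (from_nat_into A j) \<in> borel_measurable M" for j
    using False by (intro assms(2) from_nat_into) auto
  thus ?thesis by (simp add: infsum_eq_suminf[OF assms(1) False])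
qed (auto intro: borel_measurable_sum assms(2))

text \<open>The hypothesis \<open>eq\<close> says that the image under \<open>T\<close> of the
  measure with density \<open>w\<close> has density \<open>u\<close>, tested on indicators. Two
  weights let one lemma serve both formulas: inside \<open>B\<close>, \<open>w\<close> carries the
  derivative of the induced map and \<open>u\<close> is an indicator; outside \<open>B\<close>,
  \<open>w\<close> is an indicator and \<open>u\<close> carries the branch sum.\<close>

lemma nn_integral_change_of_variables:
  assumes [measurable]: "T \<in> borel_measurable M" "A \<in> sets M" "w \<in> borel_measurable M" "u \<in> borel_measurable M"
    and M: "sets M = sets borel"
    and eq: "\<And>D. D \<in> sets borel \<Longrightarrow> (\<integral>\<^sup>+x. w x * indicator D (T x) \<partial>M) = (\<integral>\<^sup>+x. u x * indicator D x \<partial>M)"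
    and [measurable]: "h \<in> borel_measurable borel"
  shows "(\<integral>\<^sup>+x. w x * h (T x) \<partial>M) = (\<integral>\<^sup>+x. u x * h x \<partial>M)"
proof -
  have [measurable_cong]: "sets M = sets borel" by (rule M)
  have "distr (density M w) borel T = density M u"
  proof (rule measure_eqI)
    fix D assume "D \<in> sets (distr (density M w) borel T)"
    hence D[measurable]: "D \<in> sets borel" by simp
    have "emeasure (distr (density M w) borel T) D = (\<integral>\<^sup>+x. w x * indicator (T -` D \<inter> space M) x \<partial>M)"
      by (subst emeasure_distr) (auto intro!: emeasure_density)
    also have "\<dots> = (\<integral>\<^sup>+x. w x * indicator D (T x) \<partial>M)"
      by (intro nn_integral_cong) (auto split: split_indicator)
    also have "\<dots> = emeasure (density M u) D"
      using M eq[OF D] by (simp add: emeasure_density)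
    finally show "emeasure (distr (density M w) borel T) D = emeasure (density M u) D" .
  qed (simp add: M)
  hence "(\<integral>\<^sup>+x. h x \<partial>distr (density M w) borel T) = (\<integral>\<^sup>+x. h x \<partial>density M u)" by simp
  thus ?thesis by (simp add: nn_integral_distr nn_integral_density)
qed

text \<open>Uniqueness of densities, localised to \<open>P\<close>. A derivative such as
  \<open>deriv_on\<close> is controlled only on its own piece, so measurability is asked only of the
  products with \<open>indicator P\<close>.\<close>

lemma AE_eq_on_if_nn_integral_eq:
  fixes f g :: "'a \<Rightarrow> ennreal"
  assumes "finite_measure M" and P[measurable]: "P \<in> sets M"
    and f: "(\<lambda>x. f x * indicator P x) \<in> borel_measurable M"
    and g: "(\<lambda>x. g x * indicator P x) \<in> borel_measurable M"
    and eq: "\<And>A. A \<in> sets M \<Longrightarrow> A \<subseteq> P \<Longrightarrow> (\<integral>\<^sup>+x\<in>A. f x \<partial>M) = (\<integral>\<^sup>+x\<in>A. g x \<partial>M)"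
  shows "AE x in M. x \<in> P \<longrightarrow> f x = g x"
proof -
  interpret finite_measure M by fact
  have "AE x in M. f x * indicator P x = g x * indicator P x"
  proof (rule density_unique_finite_measure[OF f g])
    fix A assume A: "A \<in> sets M"
    have *: "h x * indicator P x * indicator A x = h x * indicator (P \<inter> A) x" for h :: "'a \<Rightarrow> ennreal" and x
      by (simp split: split_indicator)
    show "(\<integral>\<^sup>+x. f x * indicator P x * indicator A x \<partial>M) = (\<integral>\<^sup>+x. g x * indicator P x * indicator A x \<partial>M)"
      unfolding * by (rule eq) (use A in auto)
  qed auto
  thus ?thesis by (rule AE_mp) (auto split: split_indicator)
qed

lemma measure_jacobian_eq:
  assumes "a \<in> P" "x \<in> a" "\<And>b. b \<in> P \<Longrightarrow> x \<in> b \<Longrightarrow> b = a"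
  shows "measure_jacobian M P T x = deriv_on M T a x"
proof -
  have "(THE a. a \<in> P \<and> x \<in> a) = a" by (rule the_equality) (simp_all only: assms)
  thus ?thesis by (simp add: measure_jacobian_def)
qed

lemma sets_restrict_space_subsets:
  "a \<in> sets M \<Longrightarrow> sets (restrict_space M a) = {A \<in> sets M. A \<subseteq> a}"
  using sets.sets_into_space by (auto simp: sets_restrict_space image_iff)

section \<open>The Radon-Nikodym derivative of an injective map on one piece\<close>

context
  fixes M :: "'a measure" and T :: "'a \<Rightarrow> 'a" and a :: "'a set"
  assumes fin: "finite_measure M"
    and a: "a \<in> sets M"
    and inj: "inj_on T a"
    and image: "\<And>A. A \<in> sets M \<Longrightarrow> A \<subseteq> a \<Longrightarrow> T ` A \<in> sets M"
    and null: "\<And>A. A \<in> sets M \<Longrightarrow> A \<subseteq> a \<Longrightarrow> emeasure M A = 0 \<Longrightarrow> emeasure M (T ` A) = 0"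
begin

text \<open>\<open>measure_of\<close> returns the intended values only if the set function really is
  a measure. Injectivity on \<open>a\<close> keeps the images of disjoint sets disjoint, which gives
  countable additivity.\<close>

lemma comp_measure_eq: "space (comp_measure M T a) = a"
    "sets (comp_measure M T a) = {A \<in> sets M. A \<subseteq> a}"
    "A \<in> sets M \<Longrightarrow> A \<subseteq> a \<Longrightarrow> emeasure (comp_measure M T a) A = emeasure M (T ` A)"
proof -
  let ?S = "{A \<in> sets M. A \<subseteq> a}"
  have "space (restrict_space M a) = a"
    using a sets.sets_into_space by (auto simp: space_restrict_space)
  hence sa: "sigma_algebra a ?S"
    using sets.sigma_algebra_axioms[of "restrict_space M a"] sets_restrict_space_subsets[OF a] by simp
  thus "space (comp_measure M T a) = a"
    unfolding comp_measure_def by (intro space_measure_of) auto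
  show "sets (comp_measure M T a) = ?S"
    unfolding comp_measure_def using sa by (simp add: sigma_algebra.sets_measure_of_eq)
  show "emeasure (comp_measure M T a) A = emeasure M (T ` A)" if A: "A \<in> sets M" "A \<subseteq> a"
    unfolding comp_measure_def
  proof (rule emeasure_measure_of_sigma[OF sa])
    show "positive ?S (\<lambda>A. emeasure M (T ` A))" by (simp add: positive_def)
    show "countably_additive ?S (\<lambda>A. emeasure M (T ` A))"
    proof (rule countably_additiveI)
      fix F :: "nat \<Rightarrow> 'a set" assume F: "range F \<subseteq> ?S" "disjoint_family F" "\<Union> (range F) \<in> ?S"
      have sub: "F i \<subseteq> a" for i using F(1) by auto
      have "disjoint_family (\<lambda>i. T ` F i)"
        unfolding disjoint_family_on_def
      proof (intro ballI impI)
        fix i j :: nat assume "i \<noteq> j"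
        hence "F i \<inter> F j = {}" using F(2) by (auto simp: disjoint_family_on_def)
        thus "T ` F i \<inter> T ` F j = {}" using inj_on_image_Int[OF inj sub sub]
          by (metis image_empty)
      qed
      moreover have "range (\<lambda>i. T ` F i) \<subseteq> sets M" using F(1) image by auto
      ultimately have "(\<Sum>i. emeasure M (T ` F i)) = emeasure M (\<Union>i. T ` F i)"
        by (intro suminf_emeasure)
      thus "(\<Sum>i. emeasure M (T ` F i)) = emeasure M (T ` \<Union> (range F))"
        by (simp add: image_UN)
    qed
  qed (use A in auto)
qed

lemma deriv_on_measurable: "(\<lambda>x. deriv_on M T a x * indicator a x) \<in> borel_measurable M"
proof -
  have "deriv_on M T a \<in> borel_measurable (restrict_space M a)"
    unfolding deriv_on_def by (rule borel_measurable_RN_deriv)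
  thus ?thesis using a by (subst (asm) borel_measurable_restrict_space_iff_ennreal) auto
qed

text \<open>Radon-Nikodym on the restricted space: \<open>null\<close> is exactly the absolute
  continuity of the composed measure.\<close>

lemma nn_integral_deriv_on:
  assumes A: "A \<in> sets M" "A \<subseteq> a"
  shows "(\<integral>\<^sup>+x\<in>A. deriv_on M T a x \<partial>M) = emeasure M (T ` A)"
proof -
  interpret R: finite_measure "restrict_space M a"
    using fin a by (intro finite_measure_restrict_space) auto
  have "absolutely_continuous (restrict_space M a) (comp_measure M T a)"
    unfolding absolutely_continuous_def
  proof
    fix A assume "A \<in> null_sets (restrict_space M a)"
    hence "A \<in> sets M" "A \<subseteq> a" "emeasure M A = 0"
      using a by (auto simp: null_sets_restrict_space)
    thus "A \<in> null_sets (comp_measure M T a)"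
      by (intro null_setsI) (simp_all add: comp_measure_eq null)
  qed
  hence density: "density (restrict_space M a) (deriv_on M T a) = comp_measure M T a"
    unfolding deriv_on_def
    by (rule R.density_RN_deriv) (simp add: comp_measure_eq sets_restrict_space_subsets[OF a])
  have A': "A \<in> sets (restrict_space M a)"
    using A by (simp add: sets_restrict_space_subsets[OF a])
  have "emeasure M (T ` A) = emeasure (comp_measure M T a) A"
    using A by (simp add: comp_measure_eq)
  also have "\<dots> = (\<integral>\<^sup>+x. deriv_on M T a x * indicator A x \<partial>restrict_space M a)"
    unfolding density[symmetric]
    by (rule emeasure_density) (simp_all add: A' deriv_on_def)
  also have "\<dots> = (\<integral>\<^sup>+x. deriv_on M T a x * indicator A x * indicator a x \<partial>M)"
    using a by (intro nn_integral_restrict_space) auto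
  also have "\<dots> = (\<integral>\<^sup>+x\<in>A. deriv_on M T a x \<partial>M)"
    using A by (intro nn_integral_cong) (auto split: split_indicator)
  finally show ?thesis by simp
qed

end

section \<open>Cylinders and the induced partition\<close>

lemma hit_time_eq_enat_iff:
  "hit_time T B x = enat k \<longleftrightarrow> 1 \<le> k \<and> (T ^^ k) x \<in> B \<and> (\<forall>j. 1 \<le> j \<and> j < k \<longrightarrow> (T ^^ j) x \<notin> B)"
    (is "_ \<longleftrightarrow> ?P k")
proof -
  have least: "hit_time T B x = enat l" if "?P l" for l
    unfolding hit_time_def
  proof (rule INF_eqI)
    show "enat l \<le> enat i" if "i \<in> {n. 1 \<le> n \<and> (T ^^ n) x \<in> B}" for i
      using that \<open>?P l\<close> by (auto simp: not_less[symmetric])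
    show "y \<le> enat l" if "\<And>i. i \<in> {n. 1 \<le> n \<and> (T ^^ n) x \<in> B} \<Longrightarrow> y \<le> enat i" for y
      using that \<open>?P l\<close> by auto
  qed
  show ?thesis
  proof
    assume eq: "hit_time T B x = enat k"
    have "{n. 1 \<le> n \<and> (T ^^ n) x \<in> B} \<noteq> {}"
    proof
      assume "{n. 1 \<le> n \<and> (T ^^ n) x \<in> B} = {}"
      hence "hit_time T B x = top" by (simp only: hit_time_def) simp
      thus False using eq by (simp add: top_enat_def)
    qed
    then obtain i where i: "1 \<le> i \<and> (T ^^ i) x \<in> B" by blast
    have "?P (LEAST i. 1 \<le> i \<and> (T ^^ i) x \<in> B)"
      using LeastI[of "\<lambda>i. 1 \<le> i \<and> (T ^^ i) x \<in> B", OF i] not_less_Least by blast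
    with least[OF this] eq show "?P k" by simp
  qed (use least in blast)
qed

lemma hit_time_funpow:
  assumes "hit_time T B x = enat l" "j < l"
  shows "hit_time T B ((T ^^ j) x) = enat (l - j)"
proof -
  have "(T ^^ (l - j)) ((T ^^ j) x) \<in> B"
    using assms
      by (auto simp: hit_time_eq_enat_iff funpow_add[symmetric] simp flip: comp_apply[of "T ^^ _"])
  moreover have "(T ^^ i) ((T ^^ j) x) \<notin> B" if "1 \<le> i" "i < l - j" for i
  proof -
    have "(T ^^ i) ((T ^^ j) x) = (T ^^ (i + j)) x" by (simp add: funpow_add)
    thus ?thesis using assms that by (auto simp: hit_time_eq_enat_iff)
  qed
  ultimately show ?thesis using assms by (auto simp: hit_time_eq_enat_iff)
qed

lemma hit_map_eq: "hit_time T B x = enat k \<Longrightarrow> hit_map T B x = (T ^^ k) x"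
  by (simp add: hit_map_def)

lemma set_hit_time_eq:
  assumes "A \<noteq> {}" "A \<subseteq> hit_set T B k"
  shows "set_hit_time T B A = k"
  unfolding set_hit_time_def using assms by (intro the_equality) (force simp: hit_set_def)+

text \<open>
  The number of steps to the first visit to \<open>B\<close> with time \<open>0\<close> allowed, written as a relation
  because the number is undefined for points that never reach \<open>B\<close>.
\<close>
definition entry_time :: "('a \<Rightarrow> 'a) \<Rightarrow> 'a set \<Rightarrow> 'a \<Rightarrow> nat \<Rightarrow> bool" where
  "entry_time T B x k \<longleftrightarrow> (T ^^ k) x \<in> B \<and> (\<forall>j<k. (T ^^ j) x \<notin> B)"

lemma entry_time_unique: "entry_time T B x k \<Longrightarrow> entry_time T B x l \<Longrightarrow> k = l"
  unfolding entry_time_def by (meson linorder_neqE_nat)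

lemma entry_time_0 [simp]: "entry_time T B x 0 \<longleftrightarrow> x \<in> B"
  by (simp add: entry_time_def)

lemma entry_time_outside:
  "x \<notin> B \<Longrightarrow> entry_time T B x k \<longleftrightarrow> hit_time T B x = enat k"
  unfolding entry_time_def hit_time_eq_enat_iff
  by (cases k) (auto simp: less_Suc_eq_0_disj simp del: funpow.simps)

text \<open>This is the reason for using entry times: if \<open>k = 0\<close>, then
  \<open>T x\<close> is already in \<open>B\<close> and its hit time would be that of the next
  return, whereas the entry time just drops by one.\<close>

lemma entry_time_image:
  assumes "hit_time T B x = enat (Suc k)"
  shows "entry_time T B (T x) k"
proof -
  have "(T ^^ j) (T x) = (T ^^ Suc j) x" for j
    by (simp add: funpow_swap1)
  thus ?thesis using assms by (auto simp: entry_time_def hit_time_eq_enat_iff simp del: funpow.simps)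
qed

section \<open>Itineraries, cylinders and the Markov property\<close>

context markov_fibred_system
begin

definition part :: "'a \<Rightarrow> 'a set" where "part x = (THE a. a \<in> \<alpha> \<and> x \<in> a)"

lemma part_eqI: "a \<in> \<alpha> \<Longrightarrow> x \<in> a \<Longrightarrow> part x = a"
  unfolding part_def using partition by (intro the_equality) (auto simp: partition_on_def disjoint_def)

lemma part_in: "part x \<in> \<alpha>" and in_part: "x \<in> part x"
proof -
  obtain a where "a \<in> \<alpha>" "x \<in> a" using partition by (auto simp: partition_on_def)
  thus "part x \<in> \<alpha>" "x \<in> part x" using part_eqI by auto
qed

lemma in_part_iff: "y \<in> part x \<longleftrightarrow> part y = part x"
  using part_eqI[OF part_in] in_part by metis

text \<open>The element of \<open>cylinders \<theta> \<alpha> L\<close> around \<open>x\<close>.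
  Indexing by a point instead of a sequence of partition elements makes it nonempty by
  construction.\<close>

definition atom :: "nat \<Rightarrow> 'a \<Rightarrow> 'a set" where
  "atom L x = {y. \<forall>k<L. part ((\<theta> ^^ k) y) = part ((\<theta> ^^ k) x)}"

lemma in_atom_self [simp]: "x \<in> atom L x"
  by (simp add: atom_def)

lemma atom_eq: "y \<in> atom L x \<Longrightarrow> atom L y = atom L x"
  by (auto simp: atom_def)

lemma atom_mono: "L \<le> M \<Longrightarrow> atom M x \<subseteq> atom L x"
  by (auto simp: atom_def)

lemma in_atom_add:
  "y \<in> atom (j + L) x \<longleftrightarrow> y \<in> atom j x \<and> (\<theta> ^^ j) y \<in> atom L ((\<theta> ^^ j) x)"
proof -
  have eq: "(\<theta> ^^ k) ((\<theta> ^^ j) z) = (\<theta> ^^ (j + k)) z" for k z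
    by (simp add: funpow_add add.commute[of j])
  have split: "(\<forall>i<j + L. P i) \<longleftrightarrow> (\<forall>i<j. P i) \<and> (\<forall>i<L. P (j + i))" for P
  proof (intro iffI allI impI)
    fix i assume P: "(\<forall>i<j. P i) \<and> (\<forall>i<L. P (j + i))" and "i < j + L"
    show "P i"
    proof (cases "i < j")
      case False
      hence "i = j + (i - j)" "i - j < L" using \<open>i < j + L\<close> by auto
      thus ?thesis using P by metis
    qed (use P in simp)
  qed simp
  show ?thesis
    unfolding atom_def mem_Collect_eq eq by (rule split)
qed

lemma in_atom_Suc: "y \<in> atom (Suc L) x \<longleftrightarrow> y \<in> part x \<and> \<theta> y \<in> atom L (\<theta> x)"
  using in_atom_add[of y 1 L x] by (auto simp: atom_def in_part_iff)

lemma atom_Suc: "atom (Suc L) x = atom L x \<inter> (\<theta> ^^ L) -` part ((\<theta> ^^ L) x)"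
  by (auto simp: atom_def in_part_iff less_Suc_eq)

lemma cylinders_eq: "cylinders \<theta> \<alpha> L = range (atom L)"
proof -
  have 1: "(\<Inter>k\<in>{..<L}. (\<theta> ^^ k) -` s k) = atom L x"
    if "\<forall>k<L. s k \<in> \<alpha>" "x \<in> (\<Inter>k\<in>{..<L}. (\<theta> ^^ k) -` s k)" for s x
  proof -
    have "s k = part ((\<theta> ^^ k) x)" if "k < L" for k
    proof (rule part_eqI[symmetric])
      show "s k \<in> \<alpha>" using that \<open>\<forall>k<L. s k \<in> \<alpha>\<close> by simp
      show "(\<theta> ^^ k) x \<in> s k" using that \<open>x \<in> _\<close> by simp
    qed
    hence "(\<Inter>k\<in>{..<L}. (\<theta> ^^ k) -` s k) = (\<Inter>k\<in>{..<L}. (\<theta> ^^ k) -` part ((\<theta> ^^ k) x))"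
      by (intro INF_cong) auto
    also have "\<dots> = atom L x" by (auto simp: atom_def in_part_iff)
    finally show ?thesis .
  qed
  have 2: "atom L x = (\<Inter>k\<in>{..<L}. (\<theta> ^^ k) -` part ((\<theta> ^^ k) x))" for x
    by (auto simp: atom_def in_part_iff)
  show ?thesis
  proof
    show "cylinders \<theta> \<alpha> L \<subseteq> range (atom L)"
    proof
      fix C assume "C \<in> cylinders \<theta> \<alpha> L"
      then obtain s where s: "\<forall>k<L. s k \<in> \<alpha>" and C: "C = (\<Inter>k\<in>{..<L}. (\<theta> ^^ k) -` s k)" and "C \<noteq> {}"
        by (simp add: cylinders_def) metis
      then obtain x where "x \<in> C" by auto
      hence "C = atom L x" unfolding C by (rule 1[OF s])
      thus "C \<in> range (atom L)" by (rule range_eqI)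
    qed
    show "range (atom L) \<subseteq> cylinders \<theta> \<alpha> L"
    proof
      fix C assume "C \<in> range (atom L)"
      then obtain x where C: "C = atom L x" by blast
      have "\<forall>k<L. part ((\<theta> ^^ k) x) \<in> \<alpha>" by (simp add: part_in)
      moreover have "C \<notin> {{}}" using in_atom_self[of x L] unfolding C by blast
      ultimately show "C \<in> cylinders \<theta> \<alpha> L"
        unfolding cylinders_def C using 2[of x]
        by (intro DiffI CollectI exI[of _ "\<lambda>k. part ((\<theta> ^^ k) x)"] conjI) simp_all
    qed
  qed
qed

lemma countable_cylinders: "countable (range (atom L))"
proof (induction L)
  case 0
  have "atom 0 = (\<lambda>_. UNIV)" by (auto simp: atom_def fun_eq_iff)
  thus ?case by simp
next
  case (Suc L)
  have "range (atom (Suc L)) \<subseteq> (\<lambda>(C, a). C \<inter> (\<theta> ^^ L) -` a) ` (range (atom L) \<times> \<alpha>)"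
    using part_in by (auto simp: atom_Suc)
  moreover have "countable ((\<lambda>(C, a). C \<inter> (\<theta> ^^ L) -` a) ` (range (atom L) \<times> \<alpha>))"
    using Suc countable_partition by blast
  ultimately show ?case by (rule countable_subset)
qed

lemma measurable_funpow [measurable]: "(\<theta> ^^ k) \<in> borel \<rightarrow>\<^sub>M borel"
proof (induction k)
  case (Suc k)
  thus ?case using measurable_comp[OF Suc measurable_map] by (simp add: comp_def)
qed (simp add: id_def)

lemma funpow_vimage_borel: "A \<in> sets borel \<Longrightarrow> (\<theta> ^^ k) -` A \<in> sets borel"
  using measurable_sets[OF measurable_funpow] by simp

lemma atom_borel [measurable]: "atom L x \<in> sets borel"
proof (induction L)
  case 0
  have "atom 0 x = UNIV" by (auto simp: atom_def)
  thus ?case by simp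
next
  case (Suc L)
  thus ?case unfolding atom_Suc
    using partition_measurable part_in by (intro sets.Int funpow_vimage_borel) auto
qed

text \<open>Not separating two points of one partition element is a property inherited under
  complements and countable unions.\<close>

lemma sigma_partition_saturated:
  assumes "S \<in> sigma_sets UNIV \<alpha>" "part x = part y"
  shows "x \<in> S \<longleftrightarrow> y \<in> S"
  using assms(1)
proof induction
  case (Basic a)
  thus ?case using assms(2) part_eqI in_part by metis
qed auto

lemma sigma_cylinders_saturated:
  assumes "S \<in> sigma_sets UNIV (cylinders \<theta> \<alpha> L)" "y \<in> atom L x"
  shows "x \<in> S \<longleftrightarrow> y \<in> S"
  using assms(1)
proof induction
  case (Basic a)
  thus ?case unfolding cylinders_eq using assms(2) atom_eq by (metis in_atom_self rangeE)
qed auto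

text \<open>This is where the Markov property enters: one can pull back along a prescribed itinerary.\<close>
lemma atom_lift:
  assumes "z \<in> atom L ((\<theta> ^^ j) x)" "1 \<le> L"
  obtains y where "y \<in> atom (j + L) x" "(\<theta> ^^ j) y = z"
  using assms
proof (induction j arbitrary: x thesis)
  case 0
  thus ?case by auto
next
  case (Suc j)
  have "z \<in> atom L ((\<theta> ^^ j) (\<theta> x))"
    using Suc.prems by (simp add: funpow_swap1)
  then obtain y where y: "y \<in> atom (j + L) (\<theta> x)" "(\<theta> ^^ j) y = z"
    using Suc.IH Suc.prems by metis
  \<comment> \<open>The symbol at position 0 is prescribed only because \<open>j + L\<close> is
    positive; for \<open>j = 0\<close> this is the assumption \<open>1 \<le> L\<close>.\<close>
  have "part y = part (\<theta> x)"
    using y(1) \<open>1 \<le> L\<close> by (auto simp: atom_def dest!: spec[of _ 0])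
  moreover have "\<theta> x \<in> \<theta> ` part x" using in_part by blast
  \<comment> \<open>By \<open>markov\<close> the image of \<open>part x\<close> is saturated, so
    together with \<open>\<theta> x\<close> it contains every point of
    \<open>part (\<theta> x)\<close>.\<close>
  ultimately have "y \<in> \<theta> ` part x"
    using sigma_partition_saturated[OF markov[OF part_in]] by blast
  then obtain w where "w \<in> part x" "\<theta> w = y" by blast
  hence "w \<in> atom (Suc j + L) x" "(\<theta> ^^ Suc j) w = z"
    using y by (auto simp: in_atom_Suc funpow_swap1)
  thus ?case using Suc.prems by blast
qed

text \<open>For \<open>L = 0\<close> the right side would be the whole space, which the image of a
  cylinder need not fill.\<close>

lemma image_atom: "1 \<le> L \<Longrightarrow> (\<theta> ^^ j) ` atom (j + L) x = atom L ((\<theta> ^^ j) x)"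
proof (intro equalityI subsetI)
  fix z assume "1 \<le> L" "z \<in> atom L ((\<theta> ^^ j) x)"
  then obtain y where "y \<in> atom (j + L) x" "(\<theta> ^^ j) y = z" using atom_lift by metis
  thus "z \<in> (\<theta> ^^ j) ` atom (j + L) x" by blast
qed (auto simp: in_atom_add)

lemma image_atom_Suc: "1 \<le> L \<Longrightarrow> \<theta> ` atom (Suc L) x = atom L (\<theta> x)"
  using image_atom[of L 1 x] by simp

lemma inj_on_atom: "j \<le> L \<Longrightarrow> inj_on (\<theta> ^^ j) (atom L x)"
proof (induction j)
  case (Suc j)
  show ?case
  proof (rule inj_onI)
    fix y z assume yz: "y \<in> atom L x" "z \<in> atom L x" "(\<theta> ^^ Suc j) y = (\<theta> ^^ Suc j) z"
    have "(\<theta> ^^ j) y \<in> part ((\<theta> ^^ j) x)" "(\<theta> ^^ j) z \<in> part ((\<theta> ^^ j) x)"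
      using yz(1,2) Suc.prems by (auto simp: atom_def in_part_iff)
    hence "(\<theta> ^^ j) y = (\<theta> ^^ j) z"
      using yz(3) inj_onD[OF invertible[OF part_in]] by auto
    thus "y = z" using Suc yz(1,2) by (auto dest: inj_onD)
  qed
qed simp

text \<open>The one-step hypotheses apply to the image under \<open>\<theta> ^^ j\<close> only once
  that image is known to be Borel and to lie in one partition element, so both claims share one
  induction.\<close>

lemma image_borel_null:
  assumes "A \<subseteq> atom L x" "A \<in> sets borel" "j \<le> L"
  shows "(\<theta> ^^ j) ` A \<in> sets borel \<and> (emeasure m ((\<theta> ^^ j) ` A) = 0 \<longleftrightarrow> emeasure m A = 0)"
  using assms(3)
proof (induction j)
  case (Suc j)
  have sub: "(\<theta> ^^ j) ` A \<subseteq> part ((\<theta> ^^ j) x)"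
    using assms(1) Suc.prems by (auto simp: atom_def in_part_iff)
  have eq: "(\<theta> ^^ Suc j) ` A = \<theta> ` (\<theta> ^^ j) ` A" by auto
  show ?case
    unfolding eq
    using image_measurable[OF part_in sub] branch_nonsingular[OF part_in sub] Suc by auto
qed (simp add: assms)

lemmas image_borel = image_borel_null[THEN conjunct1]
lemmas image_null_iff = image_borel_null[THEN conjunct2]

lemma null_vimage_funpow:
  "A \<in> sets borel \<Longrightarrow> emeasure m ((\<theta> ^^ k) -` A) = 0 \<longleftrightarrow> emeasure m A = 0"
proof (induction k)
  case (Suc k)
  have "(\<theta> ^^ Suc k) -` A = \<theta> -` ((\<theta> ^^ k) -` A)"
    by (auto simp: funpow_swap1)
  thus ?case using Suc funpow_vimage_borel nonsingular by metis
qed simp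

end

section \<open>The induced partition, its inverse branches and the index sets\<close>

locale inducing_set = markov_fibred_system m \<theta> \<alpha>
  for m :: "'a::polish_space measure" and \<theta> \<alpha> +
  fixes B :: "'a set" and n :: nat
  assumes n_pos: "1 \<le> n"
    and B_sigma: "B \<in> sigma_sets UNIV (cylinders \<theta> \<alpha> n)"
begin

abbreviation "\<alpha>' \<equiv> induced_partition \<theta> \<alpha> n B"
abbreviation "N \<equiv> hit_time \<theta> B"

lemma B_borel [measurable]: "B \<in> sets borel"
proof -
  have "cylinders \<theta> \<alpha> n \<subseteq> sets borel" by (auto simp: cylinders_eq atom_borel)
  thus ?thesis using B_sigma sets.sigma_sets_subset[of _ borel] by (auto simp: space_borel)
qed

text \<open>Membership in \<open>B\<close> depends on \<open>n\<close> symbols, hence membership at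
  time \<open>j\<close> on the first \<open>n + j\<close>. This is the source of the length
  \<open>n + k\<close> used throughout.\<close>

lemma funpow_in_B_iff:
  assumes "y \<in> atom (n + k) x" "j \<le> k"
  shows "(\<theta> ^^ j) y \<in> B \<longleftrightarrow> (\<theta> ^^ j) x \<in> B"
proof -
  have "y \<in> atom (j + n) x" using assms atom_mono[of "j + n" "n + k" x] by auto
  hence "(\<theta> ^^ j) y \<in> atom n ((\<theta> ^^ j) x)" by (simp add: in_atom_add)
  thus ?thesis using sigma_cylinders_saturated[OF B_sigma] by blast
qed

lemma hit_time_atom:
  "y \<in> atom (n + k) x \<Longrightarrow> N y = enat k \<longleftrightarrow> N x = enat k"
  unfolding hit_time_eq_enat_iff by (simp add: funpow_in_B_iff cong: conj_cong)

lemma entry_time_atom: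
  "y \<in> atom (n + k) x \<Longrightarrow> entry_time \<theta> B y k \<longleftrightarrow> entry_time \<theta> B x k"
  unfolding entry_time_def by (simp add: funpow_in_B_iff cong: conj_cong)

text \<open>The length of the cylinder is not free: \<open>a\<close> lies in a single hit set, so
  \<open>k\<close> must be the return time of \<open>x\<close>. In particular at most one element of
  the induced partition contains \<open>x\<close>.\<close>

lemma in_induced_partition_iff:
  "x \<in> a \<and> a \<in> \<alpha>' \<longleftrightarrow> (\<exists>k. x \<in> B \<and> N x = enat k \<and> a = atom (n + k) x)"
proof
  assume "x \<in> a \<and> a \<in> \<alpha>'"
  then obtain k where k: "x \<in> a" "a \<in> range (atom (n + k))" "a \<subseteq> B \<inter> hit_set \<theta> B k"
    by (auto simp: induced_partition_def cylinders_eq)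
  hence "a = atom (n + k) x" using atom_eq by fastforce
  thus "\<exists>k. x \<in> B \<and> N x = enat k \<and> a = atom (n + k) x" using k
    by (intro exI[of _ k]) (auto simp: hit_set_def)
next
  assume "\<exists>k. x \<in> B \<and> N x = enat k \<and> a = atom (n + k) x"
  then obtain k where k: "x \<in> B" "N x = enat k" "a = atom (n + k) x" by blast
  have "a \<subseteq> B \<inter> hit_set \<theta> B k"
    using k hit_time_atom funpow_in_B_iff[where j = 0] by (auto simp: hit_set_def)
  thus "x \<in> a \<and> a \<in> \<alpha>'" using k by (auto simp: induced_partition_def cylinders_eq)
qed

lemma induced_partitionE:
  assumes "a \<in> \<alpha>'"
  obtains x k where "x \<in> B" "N x = enat k" "a = atom (n + k) x" "set_hit_time \<theta> B a = k" "1 \<le> k"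
    "a \<subseteq> B" "\<And>y. y \<in> a \<Longrightarrow> N y = enat k"
proof -
  obtain k where a: "a \<in> range (atom (n + k))" "a \<subseteq> B \<inter> hit_set \<theta> B k"
    using assms by (auto simp: induced_partition_def cylinders_eq)
  then obtain x where x: "a = atom (n + k) x" by blast
  hence "x \<in> a" by simp
  have N: "N y = enat k" if "y \<in> a" for y using a(2) that by (auto simp: hit_set_def)
  show ?thesis
  proof (rule that)
    show "x \<in> B" "a \<subseteq> B" using a(2) \<open>x \<in> a\<close> by auto
    show "N x = enat k" by (rule N[OF \<open>x \<in> a\<close>])
    thus "1 \<le> k" by (simp add: hit_time_eq_enat_iff)
    show "set_hit_time \<theta> B a = k" using a(2) \<open>x \<in> a\<close>
      by (intro set_hit_time_eq) auto
  qed (fact x N)+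
qed

lemma countable_induced_partition: "countable \<alpha>'"
proof -
  have "\<alpha>' \<subseteq> (\<Union>k. range (atom (n + k)))"
    by (auto simp: induced_partition_def cylinders_eq)
  thus ?thesis using countable_cylinders by (auto intro: countable_subset)
qed

lemma induced_borel: "a \<in> \<alpha>' \<Longrightarrow> a \<in> sets borel"
  by (erule induced_partitionE) simp

abbreviation "Na \<equiv> set_hit_time \<theta> B"

lemma set_hit_time: "a \<in> \<alpha>' \<Longrightarrow> y \<in> a \<Longrightarrow> N y = enat (Na a)"
  by (erule induced_partitionE) simp

lemma hit_map_induced: "a \<in> \<alpha>' \<Longrightarrow> y \<in> a \<Longrightarrow> hit_map \<theta> B y = (\<theta> ^^ Na a) y"
  by (rule hit_map_eq) (rule set_hit_time)

lemma hit_map_image: "a \<in> \<alpha>' \<Longrightarrow> A \<subseteq> a \<Longrightarrow> hit_map \<theta> B ` A = (\<theta> ^^ Na a) ` A"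
  by (rule image_cong) (auto dest: hit_map_induced)

lemma inj_on_hit_map: "a \<in> \<alpha>' \<Longrightarrow> inj_on (hit_map \<theta> B) a"
proof -
  assume a: "a \<in> \<alpha>'"
  have "inj_on (\<theta> ^^ Na a) a"
    using a by (rule induced_partitionE) (simp add: inj_on_atom)
  thus ?thesis using inj_on_cong[of a "hit_map \<theta> B"] hit_map_induced[OF a] by metis
qed

lemma induced_image_borel:
  "a \<in> \<alpha>' \<Longrightarrow> A \<subseteq> a \<Longrightarrow> A \<in> sets borel \<Longrightarrow> j \<le> Na a \<Longrightarrow> (\<theta> ^^ j) ` A \<in> sets borel"
  by (erule induced_partitionE) (auto intro: image_borel)

text \<open>Turning images under the inverse branch into preimages inside \<open>a\<close> makes
  their measurability a consequence of that of \<open>\<theta>\<close>.\<close>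

lemma inverse_branch_image:
  assumes "a \<in> \<alpha>'" "D \<subseteq> hit_map \<theta> B ` a"
  shows "inverse_branch \<theta> B a ` D = a \<inter> (\<theta> ^^ Na a) -` D"
proof -
  note inj = inj_on_hit_map[OF assms(1)]
  have "inverse_branch \<theta> B a ` D = a \<inter> hit_map \<theta> B -` D"
  proof (intro equalityI subsetI)
    fix x assume "x \<in> inverse_branch \<theta> B a ` D"
    then obtain d where "d \<in> D" "x = the_inv_into a (hit_map \<theta> B) d"
      by (auto simp: inverse_branch_def)
    thus "x \<in> a \<inter> hit_map \<theta> B -` D"
      using assms(2) the_inv_into_into[OF inj] f_the_inv_into_f[OF inj] by auto
  next
    fix x assume "x \<in> a \<inter> hit_map \<theta> B -` D"
    thus "x \<in> inverse_branch \<theta> B a ` D"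
      by (intro image_eqI[of _ _ "hit_map \<theta> B x"])
        (auto simp: inverse_branch_def the_inv_into_f_f[OF inj])
  qed
  thus ?thesis using hit_map_induced[OF assms(1)] by auto
qed

lemma inj_on_inverse_branch: "a \<in> \<alpha>' \<Longrightarrow> inj_on (inverse_branch \<theta> B a) (hit_map \<theta> B ` a)"
  unfolding inverse_branch_def by (intro inj_on_the_inv_into inj_on_hit_map)

text \<open>Both cases of \<open>Z\<close> in one formula, with \<open>k\<close> the entry time of
  \<open>x\<close> (so \<open>k = 0\<close> on \<open>B\<close>). Only the point \<open>x\<close> is
  required to lie in the image of \<open>a\<close>; that a whole cylinder around \<open>x\<close>
  does so is then automatic, by \<open>preimage_branches_eq\<close>.\<close>

definition preimage_branches :: "nat \<Rightarrow> 'a \<Rightarrow> 'a set set" where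
  "preimage_branches k x = {a \<in> \<alpha>'. k < Na a \<and> x \<in> (\<theta> ^^ (Na a - k)) ` a}"

lemma induced_image_atom:
  assumes "a \<in> \<alpha>'" "k \<le> Na a"
  obtains z where "(\<theta> ^^ (Na a - k)) ` a = atom (n + k) z"
proof -
  obtain x l where a: "a = atom (n + l) x" "Na a = l"
    using induced_partitionE[OF assms(1)] by metis
  have "(\<theta> ^^ (l - k)) ` a = atom (n + k) ((\<theta> ^^ (l - k)) x)"
    using image_atom[of "n + k" "l - k" x] n_pos assms a by (simp add: add.commute)
  thus ?thesis using that a by metis
qed

lemma preimage_branch_atom_subset:
  assumes "a \<in> preimage_branches k x" "k \<le> j"
  shows "atom (n + j) x \<subseteq> (\<theta> ^^ (Na a - k)) ` a"
proof -
  have "a \<in> \<alpha>'" "k \<le> Na a" "x \<in> (\<theta> ^^ (Na a - k)) ` a"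
    using assms by (auto simp: preimage_branches_def)
  then obtain z where "(\<theta> ^^ (Na a - k)) ` a = atom (n + k) z" "x \<in> atom (n + k) z"
    using induced_image_atom[of a k] by metis
  thus ?thesis using atom_eq atom_mono[of "n + k" "n + j" x] assms(2) by auto
qed

text \<open>The image of \<open>a\<close> is itself a cylinder of length \<open>n + k\<close>, so it
  contains every longer cylinder around each of its points. The length is left open because the
  cylinders in the definition of \<open>Z\<close> also record the next return and are longer than
  \<open>n + k\<close>.\<close>

lemma preimage_branches_eq:
  assumes "k \<le> j"
  shows "preimage_branches k x = {a \<in> \<alpha>'. k < Na a \<and> atom (n + j) x \<subseteq> (\<theta> ^^ (Na a - k)) ` a}"
  using preimage_branch_atom_subset[OF _ assms] in_atom_self
  unfolding preimage_branches_def by blast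

lemma preimage_branches_cong:
  "y \<in> atom (n + k) x \<Longrightarrow> preimage_branches k y = preimage_branches k x"
  by (simp add: preimage_branches_eq[OF order_refl] atom_eq)

lemma Z_point_inside:
  assumes "x \<in> B" "N x = enat k"
  shows "Z_point \<theta> \<alpha> B \<alpha>' x = preimage_branches 0 x"
proof -
  have the: "(THE b. b \<in> \<alpha>' \<and> x \<in> b) = atom (n + k) x"
    using in_induced_partition_iff[of x] assms by (intro the_equality) auto
  have sub: "atom (n + k) x \<subseteq> B"
    using funpow_in_B_iff[where j = 0] assms by auto
  \<comment> \<open>For \<open>k = 0\<close> the condition \<open>k < Na a\<close> must hold
    automatically, as \<open>Z_set\<close> has no such condition inside \<open>B\<close>.\<close>
  have "0 < Na a" if "a \<in> \<alpha>'" for a using induced_partitionE[OF that] by force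
  thus ?thesis
    unfolding Z_point_def the Z_set_def preimage_branches_eq[of 0 k, simplified]
    using assms sub by auto
qed

text \<open>
  The cylinder in the definition of \<open>Z_point\<close> is not determined by its length, since cylinders
  of different lengths may coincide as sets; it is determined because \<open>\<theta>\<^sup>k\<close> is injective on
  cylinders of length at least \<open>k\<close>.
\<close>
lemma Z_point_outside:
  assumes "x \<notin> B" "N x = enat k" "N ((\<theta> ^^ k) x) = enat k'"
  shows "Z_point \<theta> \<alpha> B \<alpha>' x = preimage_branches k x"
proof -
  \<comment> \<open>The length is chosen so that after \<open>k\<close> steps exactly
    \<open>n + k'\<close> symbols remain, the length of the induced cylinder around the point of
    entry.\<close>
  define b where "b = atom (n + (k + k')) x"
  have xB: "(\<theta> ^^ k) x \<in> B" using assms(2) by (simp add: hit_time_eq_enat_iff)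
  have e: "atom (n + k') ((\<theta> ^^ k) x) \<in> \<alpha>'"
    using in_induced_partition_iff xB assms(3) by blast
  have b_image: "(\<theta> ^^ k) ` b = atom (n + k') ((\<theta> ^^ k) x)"
    using image_atom[of "n + k'" k x] n_pos by (simp add: b_def ac_simps)
  have hit: "y \<notin> B \<and> N y = enat k" if "y \<in> b" for y
    using that funpow_in_B_iff[of y "k + k'" x 0] hit_time_atom[of y k x] assms(1,2)
      atom_mono[of "n + k" "n + (k + k')" x] by (auto simp: b_def)
  have b_sub: "b \<subseteq> hit_set \<theta> B k - B" using hit by (auto simp: hit_set_def)
  have the: "(THE b. x \<in> b \<and> (\<exists>n l. n \<le> l \<and> b \<in> cylinders \<theta> \<alpha> l \<and> b \<subseteq> hit_set \<theta> B n - B \<and>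
      (\<theta> ^^ n) ` b \<in> \<alpha>')) = b"
  proof (rule the_equality)
    have "k \<le> n + (k + k') \<and> b \<in> cylinders \<theta> \<alpha> (n + (k + k')) \<and> b \<subseteq> hit_set \<theta> B k - B \<and>
        (\<theta> ^^ k) ` b \<in> \<alpha>'"
      using e b_image b_sub by (auto simp: b_def cylinders_eq)
    thus "x \<in> b \<and> (\<exists>n l. n \<le> l \<and> b \<in> cylinders \<theta> \<alpha> l \<and> b \<subseteq> hit_set \<theta> B n - B \<and>
      (\<theta> ^^ n) ` b \<in> \<alpha>')"
      using in_atom_self[of x] unfolding b_def by blast
  next
    fix c assume c: "x \<in> c \<and> (\<exists>n l. n \<le> l \<and> c \<in> cylinders \<theta> \<alpha> l \<and> c \<subseteq> hit_set \<theta> B n - B \<and>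
      (\<theta> ^^ n) ` c \<in> \<alpha>')"
    then obtain i l where "i \<le> l" "c \<in> range (atom l)" "c \<subseteq> hit_set \<theta> B i - B" "(\<theta> ^^ i) ` c \<in> \<alpha>'" "x \<in> c"
      by (auto simp: cylinders_eq)
    moreover from this have "i = k" using assms(2) by (auto simp: hit_set_def)
    moreover from calculation have "c = atom l x" using atom_eq by fastforce
    ultimately have l: "k \<le> l" "c = atom l x" "(\<theta> ^^ k) ` c \<in> \<alpha>'" by auto
    have ck: "(\<theta> ^^ k) ` c = atom (n + k') ((\<theta> ^^ k) x)"
      using l in_induced_partition_iff[of "(\<theta> ^^ k) x" "(\<theta> ^^ k) ` c"] assms(3) by auto
    \<comment> \<open>The length of \<open>c\<close> is unknown, but \<open>c\<close> and
      \<open>b\<close> lie in \<open>atom k x\<close>, where \<open>\<theta> ^^ k\<close> is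
      injective, and have the same image there.\<close>
    show "c = b"
    proof (intro equalityI subsetI)
      fix y assume "y \<in> c"
      hence "y \<in> atom k x" "(\<theta> ^^ k) y \<in> atom (n + k') ((\<theta> ^^ k) x)"
        using l atom_mono ck by blast+
      hence "y \<in> atom (k + (n + k')) x" by (simp add: in_atom_add)
      thus "y \<in> b" by (simp add: b_def ac_simps)
    next
      fix y assume y: "y \<in> b"
      hence "(\<theta> ^^ k) y \<in> (\<theta> ^^ k) ` c" using ck b_image by blast
      then obtain z where z: "z \<in> c" "(\<theta> ^^ k) z = (\<theta> ^^ k) y" by force
      have "z \<in> atom k x" "y \<in> atom k x"
        using z y l atom_mono[of k l x] atom_mono[of k "n + (k + k')" x] by (auto simp: b_def)
      hence "z = y" using inj_on_atom[of k k x] z(2) by (auto dest: inj_onD)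
      thus "y \<in> c" using z by simp
    qed
  qed
  have "b \<noteq> {}" unfolding b_def using in_atom_self by blast
  moreover have "b \<subseteq> hit_set \<theta> B k" using b_sub by blast
  ultimately have "Na b = k" by (rule set_hit_time_eq)
  moreover have "\<not> b \<subseteq> B" using assms(1) in_atom_self unfolding b_def by blast
  moreover have "preimage_branches k x = {a \<in> \<alpha>'. k < Na a \<and> b \<subseteq> (\<theta> ^^ (Na a - k)) ` a}"
    unfolding b_def by (rule preimage_branches_eq) simp
  ultimately show ?thesis
    unfolding Z_point_def if_not_P[OF assms(1)] the Z_set_def by (simp add: Let_def)
qed

lemma Z_point_eq:
  assumes "entry_time \<theta> B x k" "N x \<noteq> \<infinity>" "N ((\<theta> ^^ k) x) \<noteq> \<infinity>"
  shows "Z_point \<theta> \<alpha> B \<alpha>' x = preimage_branches k x"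
proof (cases "x \<in> B")
  case True
  hence "k = 0" using entry_time_unique[OF assms(1)] by simp
  thus ?thesis using Z_point_inside[OF True] assms(2) by auto
next
  case False
  thus ?thesis using Z_point_outside[OF False] assms by (auto simp: entry_time_outside)
qed

text \<open>A point of \<open>a\<close> whose return lands in the image of \<open>A\<close> under
  \<open>\<theta> ^^ k\<close> must pass through \<open>A\<close> itself: \<open>A\<close> is
  covered by the image of \<open>a\<close>, and the return map is injective on \<open>a\<close>.
  Thus a piece of the tower over \<open>A\<close> becomes the image of a subset of \<open>B\<close>
  under an inverse branch, which \<open>branch_deriv\<close> can measure.\<close>

lemma preimage_branch_vimage:
  assumes a: "a \<in> preimage_branches k x" and A: "A \<subseteq> atom (n + k) x"
  shows "a \<inter> (\<theta> ^^ (Na a - k)) -` A = a \<inter> (\<theta> ^^ Na a) -` (\<theta> ^^ k) ` A"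
    and "(\<theta> ^^ k) ` A \<subseteq> hit_map \<theta> B ` a"
proof -
  have a': "a \<in> \<alpha>'" "k < Na a" using a by (auto simp: preimage_branches_def)
  have split: "(\<theta> ^^ Na a) y = (\<theta> ^^ k) ((\<theta> ^^ (Na a - k)) y)" for y
    using a'(2) by (simp add: funpow_add[symmetric] flip: comp_apply[of "\<theta> ^^ _"])
  have sub: "A \<subseteq> (\<theta> ^^ (Na a - k)) ` a"
    using preimage_branch_atom_subset[OF a order_refl] A by blast
  have inj: "inj_on (\<theta> ^^ Na a) a"
    using inj_on_hit_map[OF a'(1)] inj_on_cong[of a "hit_map \<theta> B"] hit_map_induced[OF a'(1)] by metis
  show "a \<inter> (\<theta> ^^ (Na a - k)) -` A = a \<inter> (\<theta> ^^ Na a) -` (\<theta> ^^ k) ` A"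
  proof (intro equalityI subsetI)
    fix y assume y: "y \<in> a \<inter> (\<theta> ^^ Na a) -` (\<theta> ^^ k) ` A"
    then obtain z where z: "z \<in> A" "(\<theta> ^^ Na a) y = (\<theta> ^^ k) z" by auto
    then obtain y' where y': "y' \<in> a" "z = (\<theta> ^^ (Na a - k)) y'" using sub by blast
    hence "(\<theta> ^^ Na a) y = (\<theta> ^^ Na a) y'" using z split by simp
    hence "y = y'" using inj y y' by (auto dest: inj_onD)
    thus "y \<in> a \<inter> (\<theta> ^^ (Na a - k)) -` A" using y y' z by auto
  qed (auto simp: split)
  show "(\<theta> ^^ k) ` A \<subseteq> hit_map \<theta> B ` a"
  proof
    fix w assume "w \<in> (\<theta> ^^ k) ` A"
    then obtain y where "y \<in> a" "w = (\<theta> ^^ k) ((\<theta> ^^ (Na a - k)) y)" using sub by blast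
    thus "w \<in> hit_map \<theta> B ` a" using split hit_map_induced[OF a'(1)] by (metis imageI)
  qed
qed

text \<open>The index set is constant on the cylinder, so a branch that misses \<open>x\<close>
  misses all of \<open>A\<close>.\<close>

lemma not_preimage_branch_vimage:
  assumes a: "a \<in> \<alpha>'" "k < Na a" "a \<notin> preimage_branches k x" and A: "A \<subseteq> atom (n + k) x"
  shows "a \<inter> (\<theta> ^^ (Na a - k)) -` A = {}"
proof (rule ccontr)
  assume "a \<inter> (\<theta> ^^ (Na a - k)) -` A \<noteq> {}"
  then obtain y where y: "y \<in> a" "(\<theta> ^^ (Na a - k)) y \<in> A" by blast
  hence "a \<in> preimage_branches k ((\<theta> ^^ (Na a - k)) y)"
    using a by (auto simp: preimage_branches_def)
  thus False using a y A preimage_branches_cong by blast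
qed

lemma hit_map_image_borel: "a \<in> \<alpha>' \<Longrightarrow> A \<subseteq> a \<Longrightarrow> A \<in> sets borel \<Longrightarrow> hit_map \<theta> B ` A \<in> sets borel"
  by (simp add: hit_map_image induced_image_borel)

lemma hit_map_image_subset: "a \<in> \<alpha>' \<Longrightarrow> A \<subseteq> a \<Longrightarrow> hit_map \<theta> B ` A \<subseteq> B"
  using set_hit_time hit_map_induced by (fastforce simp: hit_time_eq_enat_iff)

lemma induced_subset: "a \<in> \<alpha>' \<Longrightarrow> a \<subseteq> B"
  by (erule induced_partitionE)

end

section \<open>Equivalence of the invariant measures with \<open>m\<close>\<close>

lemma not_in_before_hit_time: "enat k < hit_time T B x \<Longrightarrow> 1 \<le> k \<Longrightarrow> (T ^^ k) x \<notin> B"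
  unfolding hit_time_def by (auto dest: less_INF_D)

lemma one_le_hit_time: "1 \<le> hit_time T B x"
  unfolding hit_time_def by (rule INF_greatest) (simp add: one_enat_def)

lemma conservative_ergodic_null:
  assumes conservative: "conservative M T" and ergodic: "ergodic M T" and space: "space M = UNIV"
    and T: "T \<in> M \<rightarrow>\<^sub>M M"
    and nonsingular: "\<And>A. A \<in> sets M \<Longrightarrow> emeasure M A = 0 \<Longrightarrow> emeasure M (T -` A) = 0"
    and \<mu>: "sets \<mu> = sets M" "emeasure \<mu> UNIV \<noteq> 0"
    and invariant: "\<And>A. A \<in> sets M \<Longrightarrow> emeasure \<mu> (T -` A) = emeasure \<mu> A"
    and ac: "\<And>A. A \<in> sets M \<Longrightarrow> emeasure M A = 0 \<Longrightarrow> emeasure \<mu> A = 0"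
    and A: "A \<in> sets M" "emeasure \<mu> A = 0"
  shows "emeasure M A = 0"
proof -
  have T_sets: "T -` C \<in> sets M" if "C \<in> sets M" for C
    using measurable_sets[OF T that] space by simp
  have pow_sets: "(T ^^ k) -` C \<in> sets M" if "C \<in> sets M" for C k
    using T_sets that by (induction k arbitrary: C) (auto simp: vimage_comp[symmetric])
  have pow_Suc: "(T ^^ Suc k) -` C = T -` ((T ^^ k) -` C)" for C k
    by (auto simp: funpow_swap1)
  have pow_Suc': "(T ^^ Suc k) -` C = (T ^^ k) -` (T -` C)" for C k
    by auto
  define E where "E = (\<Union>k. (T ^^ k) -` A)"
  define F where "F = (\<Inter>k. (T ^^ k) -` E)"
  have E: "E \<in> sets M" unfolding E_def using pow_sets A by blast
  have F: "F \<in> sets M" unfolding F_def using pow_sets E by blast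
  have "emeasure \<mu> ((T ^^ k) -` A) = 0" for k
  proof (induction k)
    case (Suc k)
    thus ?case unfolding pow_Suc using invariant pow_sets A by simp
  qed (simp add: A)
  hence "(T ^^ k) -` A \<in> null_sets \<mu>" for k
    using pow_sets A \<mu> by (simp add: null_sets_def)
  hence E_null: "E \<in> null_sets \<mu>" unfolding E_def by blast
  have TE: "T -` E \<subseteq> E"
  proof
    fix x assume "x \<in> T -` E"
    then obtain k where "x \<in> T -` ((T ^^ k) -` A)" by (auto simp: E_def)
    hence "x \<in> (T ^^ Suc k) -` A" by (simp only: pow_Suc)
    thus "x \<in> E" unfolding E_def by blast
  qed
  have decreasing: "(T ^^ j) -` E \<subseteq> (T ^^ i) -` E" if "i \<le> j" for i j
  proof (rule lift_Suc_antimono_le[OF _ that])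
    show "(T ^^ Suc k) -` E \<subseteq> (T ^^ k) -` E" for k
      unfolding pow_Suc' by (rule vimage_mono) (rule TE)
  qed
  \<comment> \<open>\<open>W\<close> is wandering: its preimages are the successive differences of a
    decreasing sequence of sets.\<close>
  define W where "W = E - T -` E"
  have W: "W \<in> sets M" unfolding W_def using E T_sets by blast
  have W_diff: "(T ^^ k) -` W = (T ^^ k) -` E - (T ^^ Suc k) -` E" for k
    unfolding W_def pow_Suc' by blast
  have W_disjoint: "disjoint_family (\<lambda>k. (T ^^ k) -` W \<inter> space M)"
    unfolding disjoint_family_on_def space
  proof (intro ballI impI)
    fix i j :: nat assume "i \<noteq> j"
    have "(T ^^ i) -` W \<inter> (T ^^ j) -` W = {}" if "i < j" for i j
      using decreasing[OF Suc_leI[OF that]] unfolding W_diff by blast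
    from this[of i j] this[of j i] have "(T ^^ i) -` W \<inter> (T ^^ j) -` W = {}"
      using \<open>i \<noteq> j\<close> by (metis Int_commute linorder_neqE_nat)
    thus "(T ^^ i) -` W \<inter> UNIV \<inter> ((T ^^ j) -` W \<inter> UNIV) = {}"
      by simp
  qed
  hence "emeasure M W = 0"
    using conservative W by (simp add: conservative_def)
  hence "emeasure M ((T ^^ k) -` W) = 0" for k
  proof (induction k)
    case (Suc k)
    thus ?case unfolding pow_Suc using nonsingular pow_sets W by simp
  qed simp
  hence W_null: "(\<Union>k. (T ^^ k) -` W) \<in> null_sets M"
    using pow_sets W by (intro null_sets_UN) (auto simp: null_sets_def)
  have "E - F \<subseteq> (\<Union>k. (T ^^ k) -` W)"
  proof
    fix x assume x: "x \<in> E - F"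
    then obtain k where k: "x \<notin> (T ^^ k) -` E" by (auto simp: F_def)
    define l where "l = (LEAST k. x \<notin> (T ^^ k) -` E)"
    have l: "x \<notin> (T ^^ l) -` E" unfolding l_def by (rule LeastI[of _ k]) (rule k)
    have "l \<noteq> 0" using l x by (metis DiffD1 eq_id_iff funpow_0 vimage_eq)
    then obtain i where i: "l = Suc i" by (cases l) auto
    have "x \<in> (T ^^ i) -` E" using not_less_Least[of i "\<lambda>k. x \<notin> (T ^^ k) -` E"] i l_def by auto
    hence "x \<in> (T ^^ i) -` W" unfolding W_diff using l i by blast
    thus "x \<in> (\<Union>k. (T ^^ k) -` W)" by blast
  qed
  hence EF: "E - F \<in> null_sets M"
    using W_null E F by (meson null_sets_subset sets.Diff)
  have "F \<subseteq> E" unfolding F_def using INT_lower[of 0 UNIV "\<lambda>k. (T ^^ k) -` E"] by simp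
  have "T -` F = F"
  proof
    show "T -` F \<subseteq> F"
    proof
      fix x assume "x \<in> T -` F"
      hence *: "x \<in> (T ^^ Suc k) -` E" for k unfolding F_def pow_Suc by blast
      have "x \<in> (T ^^ k) -` E" for k
        by (rule subsetD[OF decreasing[of k "Suc k"] *]) simp
      thus "x \<in> F" unfolding F_def by blast
    qed
    show "F \<subseteq> T -` F"
    proof
      fix x assume "x \<in> F"
      hence "x \<in> (T ^^ Suc k) -` E" for k unfolding F_def by blast
      hence "T x \<in> (T ^^ k) -` E" for k by (simp only: pow_Suc vimage_eq)
      thus "x \<in> T -` F" unfolding F_def by blast
    qed
  qed
  hence "emeasure M F = 0 \<or> emeasure M (UNIV - F) = 0"
    using ergodic F by (simp add: ergodic_def space)
  \<comment> \<open>Otherwise \<open>ac\<close> would make the complement of \<open>F\<close> null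
    for \<open>\<mu>\<close> as well, and \<open>F\<close> is already \<open>\<mu>\<close>-null as a
    subset of \<open>E\<close>.\<close>
  moreover have "emeasure M (UNIV - F) \<noteq> 0"
  proof
    assume "emeasure M (UNIV - F) = 0"
    hence "emeasure \<mu> (UNIV - F) = 0"
      using ac[of "UNIV - F"] F space sets.top[of M] by auto
    moreover have "emeasure \<mu> F = 0"
      using E_null \<open>F \<subseteq> E\<close> F \<mu> by (metis null_setsD1 null_sets_subset)
    ultimately have "emeasure \<mu> (F \<union> (UNIV - F)) = 0"
      using F \<mu> sets.top[of M] space
        by (intro emeasure_Un_null_set[THEN trans]) (auto simp: null_sets_def)
    thus False using \<mu> by (simp add: Un_absorb1 Un_commute)
  qed
  ultimately have "F \<in> null_sets M" using F by (simp add: null_sets_def)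
  hence "F \<union> (E - F) \<in> null_sets M" using EF by blast
  moreover have "A \<subseteq> E" unfolding E_def using UN_upper[of 0 UNIV "\<lambda>k. (T ^^ k) -` A"] by simp
  hence "A \<subseteq> F \<union> (E - F)" by blast
  ultimately have "A \<in> null_sets M" using A by (metis null_sets_subset)
  thus ?thesis by (rule null_setsD1)
qed

section \<open>Kac's formula and the null sets of \<nu> and \<nu>'\<close>

locale kac_system = inducing_set m \<theta> \<alpha> B n
  for m :: "'a::polish_space measure" and \<theta> \<alpha> B n +
  fixes \<nu>' \<nu> :: "'a measure"
  assumes conservative: "conservative m \<theta>" and ergodic: "ergodic m \<theta>"
    and nu'_sets: "sets \<nu>' = sets (restrict_space m B)"
    and nu'_invariant: "invariant_measure \<nu>' (hit_map \<theta> B)"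
    and nu'_ac: "absolutely_continuous (restrict_space m B) \<nu>'"
    and nu'_finite: "(\<integral>\<^sup>+ \<omega>. ennreal_of_enat (N \<omega>) \<partial>\<nu>') < \<infinity>"
    and nu_sets: "sets \<nu> = sets borel"
    and nu_prob: "prob_space \<nu>"
    and nu_invariant: "invariant_measure \<nu> \<theta>"
    and kac: "\<And>f :: 'a \<Rightarrow> ennreal. f \<in> borel_measurable borel \<Longrightarrow>
      (\<integral>\<^sup>+ \<omega>. f \<omega> \<partial>\<nu>) =
        1 / (\<integral>\<^sup>+ \<omega>. ennreal_of_enat (N \<omega>) \<partial>\<nu>') *
        (\<integral>\<^sup>+ \<omega>. (\<Sum>\<^sub>\<infinity>k\<in>{k. enat k < N \<omega>}. f ((\<theta> ^^ k) \<omega>)) \<partial>\<nu>')"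
begin

sublocale nu: prob_space \<nu> by (rule nu_prob)

declare nu_sets [measurable_cong]

definition c :: ennreal where "c = (\<integral>\<^sup>+ \<omega>. ennreal_of_enat (N \<omega>) \<partial>\<nu>')"

lemma space_m: "space m = UNIV"
  using sets_eq_imp_space_eq[OF sets_m] by simp

lemma space_nu: "space \<nu> = UNIV"
  using sets_eq_imp_space_eq[OF nu_sets] by simp

lemma sets_nu': "sets \<nu>' = {A \<in> sets borel. A \<subseteq> B}"
  unfolding nu'_sets by (subst sets_restrict_space_subsets) (simp_all add: sets_m)

lemma space_nu': "space \<nu>' = B"
  using sets_eq_imp_space_eq[OF nu'_sets] by (simp add: space_restrict_space space_m)

text \<open>Since the return time is at least 1, finiteness of \<open>\<nu>'\<close> is inherited
  from that of its integral.\<close>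

lemma emeasure_nu'_le: "emeasure \<nu>' B \<le> c"
proof -
  have "emeasure \<nu>' B = (\<integral>\<^sup>+ \<omega>. 1 \<partial>\<nu>')" by (simp add: space_nu')
  also have "\<dots> \<le> c" unfolding c_def
  proof (rule nn_integral_mono)
    have "ennreal_of_enat 1 \<le> ennreal_of_enat (N x)" for x
      using one_le_hit_time by (subst ennreal_of_enat_le_iff)
    thus "1 \<le> ennreal_of_enat (N x)" for x by simp
  qed
  finally show ?thesis .
qed

lemma c_finite: "c < \<infinity>" and c_pos: "0 < c"
proof -
  show "c < \<infinity>" using nu'_finite by (simp add: c_def)
  \<comment> \<open>If \<open>\<nu>'\<close> vanished, Kac's formula for the constant 1 would give
    \<open>\<nu>\<close> total mass 0: the integral is then 0, and so is its product with
    \<open>1 / c\<close>, even if \<open>1 / c\<close> is infinite.\<close>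
  have "emeasure \<nu>' B \<noteq> 0"
  proof
    assume "emeasure \<nu>' B = 0"
    hence ae: "AE x in \<nu>'. False"
      by (intro AE_I'[of B]) (auto simp: null_sets_def sets_nu' B_borel space_nu')
    have "(\<integral>\<^sup>+ x. 1 \<partial>\<nu>) = 1 / c * (\<integral>\<^sup>+ \<omega>. (\<Sum>\<^sub>\<infinity>k\<in>{k. enat k < N \<omega>}. 1) \<partial>\<nu>')"
      unfolding c_def by (rule kac) simp
    also have "(\<integral>\<^sup>+ \<omega>. (\<Sum>\<^sub>\<infinity>k\<in>{k. enat k < N \<omega>}. 1 :: ennreal) \<partial>\<nu>') = (\<integral>\<^sup>+ \<omega>. 0 \<partial>\<nu>')"
      using ae by (intro nn_integral_cong_AE) auto
    finally show False using nu.emeasure_space_1 by simp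
  qed
  thus "0 < c" using emeasure_nu'_le by (metis le_zero_eq zero_less_iff_neq_zero)
qed

lemma mult_inverse_c: "1 / c * (c * x) = x"
proof -
  have "1 / c * (c * x) = (c * (1 / c)) * x" by (simp only: mult.assoc mult.left_commute mult.commute)
  also have "c * (1 / c) = 1"
    using c_pos c_finite by (simp add: ennreal_times_divide ennreal_divide_self)
  finally show ?thesis by simp
qed

sublocale nu': finite_measure \<nu>'
  using emeasure_nu'_le c_finite by (intro finite_measureI) (auto simp: space_nu' top_unique)

lemma hit_set_borel [measurable]: "hit_set \<theta> B k \<in> sets borel"
proof -
  have "hit_set \<theta> B k = (if 1 \<le> k then (\<theta> ^^ k) -` B - (\<Union>j\<in>{1..<k}. (\<theta> ^^ j) -` B) else {})"
    by (auto simp: hit_set_def hit_time_eq_enat_iff)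
  thus ?thesis using funpow_vimage_borel by auto
qed

definition never_hit :: "'a set" where "never_hit = {x. N x = \<infinity>}"

lemma never_hit_borel [measurable]: "never_hit \<in> sets borel"
proof -
  have "never_hit = UNIV - (\<Union>k. hit_set \<theta> B k)"
    by (auto simp: never_hit_def hit_set_def)
  thus ?thesis by simp
qed

text \<open>An infinite return time on a set of positive measure would make the finite integral
  \<open>c\<close> infinite.\<close>

lemma AE_nu'_hit: "AE x in \<nu>'. N x \<noteq> \<infinity>"
proof -
  let ?I = "B \<inter> never_hit"
  have I: "?I \<in> sets \<nu>'" by (simp add: sets_nu')
  have "\<infinity> * emeasure \<nu>' ?I = (\<integral>\<^sup>+ x. \<infinity> * indicator ?I x \<partial>\<nu>')"
    by (rule nn_integral_cmult_indicator[symmetric, OF I])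
  also have "\<dots> \<le> c" unfolding c_def
    by (intro nn_integral_mono) (auto simp: never_hit_def split: split_indicator)
  finally have "emeasure \<nu>' ?I = 0"
    using c_finite by (auto simp: ennreal_top_mult split: if_splits)
  thus ?thesis using I
    by (intro AE_I'[of ?I]) (auto simp: null_sets_def never_hit_def space_nu')
qed

lemma nu_null_if:
  assumes A: "A \<in> sets borel"
    and ae: "AE x in \<nu>'. \<forall>k. enat k < N x \<longrightarrow> (\<theta> ^^ k) x \<notin> A"
  shows "emeasure \<nu> A = 0"
proof -
  have "emeasure \<nu> A = (\<integral>\<^sup>+ x. indicator A x \<partial>\<nu>)" using A
    by (simp add: nu_sets)
  also have "\<dots> = 1 / c * (\<integral>\<^sup>+ \<omega>. (\<Sum>\<^sub>\<infinity>k\<in>{k. enat k < N \<omega>}. indicator A ((\<theta> ^^ k) \<omega>)) \<partial>\<nu>')"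
    unfolding c_def using A by (intro kac) simp
  also have "(\<integral>\<^sup>+ \<omega>. (\<Sum>\<^sub>\<infinity>k\<in>{k. enat k < N \<omega>}. indicator A ((\<theta> ^^ k) \<omega>) :: ennreal) \<partial>\<nu>') = (\<integral>\<^sup>+ \<omega>. 0 \<partial>\<nu>')"
    using ae by (intro nn_integral_cong_AE, eventually_elim) (auto intro!: infsum_0)
  finally show ?thesis by simp
qed

lemma nu_ac: "A \<in> sets borel \<Longrightarrow> emeasure m A = 0 \<Longrightarrow> emeasure \<nu> A = 0"
proof (rule nu_null_if)
  assume A: "A \<in> sets borel" "emeasure m A = 0"
  have "AE x in \<nu>'. (\<theta> ^^ k) x \<notin> A" for k
  proof -
    have "B \<inter> (\<theta> ^^ k) -` A \<in> null_sets m"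
      using A null_vimage_funpow[of A k] funpow_vimage_borel[of A k] null_set_Int1[of "(\<theta> ^^ k) -` A" m B]
      by (simp add: null_sets_def sets_m Int_commute[of B])
    hence "B \<inter> (\<theta> ^^ k) -` A \<in> null_sets (restrict_space m B)"
      by (subst null_sets_restrict_space) (auto simp: sets_m)
    hence "B \<inter> (\<theta> ^^ k) -` A \<in> null_sets \<nu>'"
      using nu'_ac by (auto simp: absolutely_continuous_def)
    thus ?thesis by (rule AE_I') (auto simp: space_nu')
  qed
  hence "AE x in \<nu>'. \<forall>k. (\<theta> ^^ k) x \<notin> A" by (simp add: AE_all_countable)
  thus "AE x in \<nu>'. \<forall>k. enat k < N x \<longrightarrow> (\<theta> ^^ k) x \<notin> A"
    by (rule AE_mp) simp
qed simp

lemma nu_vimage: "A \<in> sets borel \<Longrightarrow> emeasure \<nu> ((\<theta> ^^ k) -` A) = emeasure \<nu> A"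
proof (induction k)
  case (Suc k)
  have "(\<theta> ^^ Suc k) -` A = \<theta> -` ((\<theta> ^^ k) -` A)"
    by (auto simp: funpow_swap1)
  moreover have "emeasure \<nu> (\<theta> -` C) = emeasure \<nu> C" if "C \<in> sets borel" for C
    using nu_invariant emeasure_distr[of \<theta> \<nu> \<nu> C] that nu_sets
    by (simp add: invariant_measure_def space_nu)
  ultimately show ?case using Suc funpow_vimage_borel by (simp del: funpow.simps)
qed simp

lemma nu_null_iff: "A \<in> sets borel \<Longrightarrow> emeasure \<nu> A = 0 \<longleftrightarrow> emeasure m A = 0"
proof
  assume A: "A \<in> sets borel" "emeasure \<nu> A = 0"
  show "emeasure m A = 0"
  proof (rule conservative_ergodic_null[OF conservative ergodic space_m])
    show "\<theta> \<in> m \<rightarrow>\<^sub>M m" using measurable_map measurable_cong_sets[OF sets_m sets_m] by blast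
    show "emeasure \<nu> UNIV \<noteq> 0" using nu.emeasure_space_1 by (simp add: space_nu)
    show "emeasure \<nu> (\<theta> -` C) = emeasure \<nu> C" if "C \<in> sets m" for C
      using nu_vimage[of C 1] that by (simp add: sets_m)
  qed (use A nonsingular nu_ac in \<open>simp_all add: sets_m nu_sets\<close>)
qed (rule nu_ac)

lemma never_hit_null: "emeasure \<nu> never_hit = 0"
proof (rule nu_null_if)
  show "AE x in \<nu>'. \<forall>k. enat k < N x \<longrightarrow> (\<theta> ^^ k) x \<notin> never_hit"
    using AE_nu'_hit
  proof eventually_elim
    fix x assume "N x \<noteq> \<infinity>"
    then obtain l where l: "N x = enat l" by auto
    thus "\<forall>k. enat k < N x \<longrightarrow> (\<theta> ^^ k) x \<notin> never_hit"
      using hit_time_funpow[OF l] by (auto simp: never_hit_def)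
  qed
qed simp

text \<open>The whole orbit is needed: \<open>Z_point_eq\<close> asks for a finite return time at
  the point of entry too, and it is applied to \<open>\<theta> x\<close> as well as to
  \<open>x\<close>.\<close>

lemma AE_nu_hit: "AE x in \<nu>. \<forall>j. N ((\<theta> ^^ j) x) \<noteq> \<infinity>"
proof -
  have "emeasure \<nu> ((\<theta> ^^ j) -` never_hit) = 0" for j
    by (simp add: nu_vimage never_hit_null)
  hence "(\<theta> ^^ j) -` never_hit \<in> null_sets \<nu>" for j
    using funpow_vimage_borel[of never_hit j] by (simp add: null_sets_def nu_sets)
  hence "AE x in \<nu>. N ((\<theta> ^^ j) x) \<noteq> \<infinity>" for j
    by (rule AE_I') (auto simp: never_hit_def)
  thus ?thesis by (simp add: AE_all_countable)
qed

text \<open>Before its return an orbit from \<open>B\<close> meets \<open>B\<close> only at time 0,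
  so for subsets of \<open>B\<close> only the ground floor of the tower contributes to Kac's
  formula. Times \<open>k\<close> below an infinite return time are covered too.\<close>

lemma emeasure_nu_eq:
  assumes A: "A \<in> sets borel" "A \<subseteq> B"
  shows "emeasure \<nu> A = 1 / c * emeasure \<nu>' A"
proof -
  have "emeasure \<nu> A = (\<integral>\<^sup>+ x. indicator A x \<partial>\<nu>)" using A
    by (simp add: nu_sets)
  also have "\<dots> = 1 / c * (\<integral>\<^sup>+ \<omega>. (\<Sum>\<^sub>\<infinity>k\<in>{k. enat k < N \<omega>}. indicator A ((\<theta> ^^ k) \<omega>)) \<partial>\<nu>')"
    unfolding c_def using A by (intro kac) simp
  also have "(\<integral>\<^sup>+ \<omega>. (\<Sum>\<^sub>\<infinity>k\<in>{k. enat k < N \<omega>}. indicator A ((\<theta> ^^ k) \<omega>) :: ennreal) \<partial>\<nu>') = (\<integral>\<^sup>+ \<omega>. indicator A \<omega> \<partial>\<nu>')"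
  proof (rule nn_integral_cong)
    fix x
    have "0 < N x" using one_le_hit_time[of \<theta> B x]
      by (metis iless_Suc_eq one_eSuc order.strict_trans1 zero_less_one not_le)
    hence "(\<Sum>\<^sub>\<infinity>k\<in>{k. enat k < N x}. indicator A ((\<theta> ^^ k) x) :: ennreal) = (\<Sum>\<^sub>\<infinity>k\<in>{0}. indicator A ((\<theta> ^^ k) x))"
      using A not_in_before_hit_time[of _ \<theta> B x]
      by (intro infsum_cong_neutral) (auto simp: zero_enat_def indicator_def Suc_le_eq)
    thus "(\<Sum>\<^sub>\<infinity>k\<in>{k. enat k < N x}. indicator A ((\<theta> ^^ k) x) :: ennreal) = indicator A x" by simp
  qed
  also have "\<dots> = emeasure \<nu>' A" using A by (simp add: sets_nu')
  finally show ?thesis .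
qed

lemma emeasure_nu'_eq:
  assumes "A \<in> sets borel" "A \<subseteq> B"
  shows "emeasure \<nu>' A = c * emeasure \<nu> A"
  by (simp only: emeasure_nu_eq[OF assms] mult.left_commute[of c] mult_inverse_c)

lemma nn_integral_nu':
  assumes f: "(\<lambda>x. f x * indicator B x) \<in> borel_measurable borel"
  shows "(\<integral>\<^sup>+x. f x \<partial>\<nu>') = c * (\<integral>\<^sup>+x. f x * indicator B x \<partial>\<nu>)"
proof -
  have "\<nu>' = restrict_space (scale_measure c \<nu>) B"
  proof (rule measure_eqI)
    show "sets \<nu>' = sets (restrict_space (scale_measure c \<nu>) B)"
      unfolding sets_nu' by (subst sets_restrict_space_subsets) (auto simp: nu_sets B_borel)
    show "emeasure \<nu>' A = emeasure (restrict_space (scale_measure c \<nu>) B) A" if "A \<in> sets \<nu>'" for A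
      using that by (subst emeasure_restrict_space) (auto simp: nu_sets sets_nu' emeasure_nu'_eq)
  qed
  hence "(\<integral>\<^sup>+x. f x \<partial>\<nu>') = (\<integral>\<^sup>+x. f x \<partial>restrict_space (scale_measure c \<nu>) B)"
    by (rule arg_cong)
  also have "\<dots> = (\<integral>\<^sup>+x. f x * indicator B x \<partial>scale_measure c \<nu>)"
    by (rule nn_integral_restrict_space) (simp add: nu_sets space_nu)
  also have "\<dots> = c * (\<integral>\<^sup>+x. f x * indicator B x \<partial>\<nu>)"
    using f by (intro nn_integral_scale_measure) (simp add: measurable_cong_sets[OF nu_sets refl])
  finally show ?thesis .
qed

lemma nu'_vimage:
  assumes D: "D \<in> sets borel" "D \<subseteq> B"
  shows "B \<inter> hit_map \<theta> B -` D \<in> sets borel" "emeasure \<nu> (B \<inter> hit_map \<theta> B -` D) = emeasure \<nu> D"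
proof -
  have T: "hit_map \<theta> B \<in> \<nu>' \<rightarrow>\<^sub>M \<nu>'" "distr \<nu>' \<nu>' (hit_map \<theta> B) = \<nu>'"
    using nu'_invariant by (auto simp: invariant_measure_def)
  have "hit_map \<theta> B -` D \<inter> B \<in> sets \<nu>'"
    using measurable_sets[OF T(1), of D] D by (simp add: sets_nu' space_nu')
  thus 1: "B \<inter> hit_map \<theta> B -` D \<in> sets borel" by (simp add: sets_nu' Int_commute)
  have "emeasure \<nu>' (hit_map \<theta> B -` D \<inter> B) = emeasure \<nu>' D"
    using emeasure_distr[OF T(1), of D] T(2) D by (simp add: sets_nu' space_nu')
  thus "emeasure \<nu> (B \<inter> hit_map \<theta> B -` D) = emeasure \<nu> D"
    using D 1 by (simp add: emeasure_nu_eq Int_commute)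
qed

end

section \<open>The derivative of \<open>\<nu> \<circ> \<theta>\<close>\<close>

context kac_system
begin

section \<open>Cutting the Kac tower along the induced partition\<close>

lemma branch_cylinder_borel: "a \<in> \<alpha>' \<Longrightarrow> A \<in> sets borel \<Longrightarrow> a \<inter> (\<theta> ^^ j) -` A \<in> sets borel"
  using sets.Int[OF induced_borel funpow_vimage_borel] by blast

text \<open>Points of \<open>A\<close> have exactly \<open>k\<close> steps to go, so an excursion of
  length \<open>l\<close> can meet \<open>A\<close> only at time \<open>l - k\<close>; and
  \<open>x\<close> lies in exactly one induced cylinder. Hence each side reduces to one term. With
  \<open>k = 0\<close> the time would be \<open>l\<close>, the return itself, which the sum
  omits.\<close>

lemma sum_before_return:
  assumes x: "x \<in> B" "N x = enat l" and k: "1 \<le> k"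
    and entry: "\<And>y. y \<in> A \<Longrightarrow> entry_time \<theta> B y k"
  shows "(\<Sum>\<^sub>\<infinity>j\<in>{j. enat j < N x}. indicator A ((\<theta> ^^ j) x) :: ennreal) =
    (\<integral>\<^sup>+a. indicator {a. k < Na a} a * indicator (a \<inter> (\<theta> ^^ (Na a - k)) -` A) x \<partial>count_space \<alpha>')"
    (is "?L = ?R")
proof -
  have time: "k < l \<and> j = l - k" if "j < l" "(\<theta> ^^ j) x \<in> A" for j
  proof -
    note e = entry[OF that(2)]
    have "j \<noteq> 0"
    proof
      assume "j = 0"
      hence "entry_time \<theta> B x k" using e by simp
      thus False using entry_time_unique[of \<theta> B x k 0] x k by simp
    qed
    moreover have "(\<theta> ^^ j) x \<notin> B"
      using not_in_before_hit_time[of j \<theta> B x] x that \<open>j \<noteq> 0\<close> by simp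
    hence "N ((\<theta> ^^ j) x) = enat k" using e by (simp add: entry_time_outside)
    hence "k = l - j" using hit_time_funpow[OF x(2) that(1)] by simp
    ultimately show ?thesis using that(1) by simp
  qed
  have "?L = (\<Sum>j<l. indicator A ((\<theta> ^^ j) x))"
    using x by (simp add: lessThan_def)
  also have "\<dots> = (if k < l then indicator A ((\<theta> ^^ (l - k)) x) else 0)"
  proof (cases "k < l")
    case True
    have "(\<Sum>j<l. indicator A ((\<theta> ^^ j) x) :: ennreal) = (\<Sum>j\<in>{l - k}. indicator A ((\<theta> ^^ j) x))"
      using True k time by (intro sum.mono_neutral_right) (auto simp: indicator_def)
    thus ?thesis using True by simp
  next
    case False
    have "(\<Sum>j<l. indicator A ((\<theta> ^^ j) x) :: ennreal) = 0"
      using False time by (intro sum.neutral) (auto simp: indicator_def)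
    thus ?thesis using False by simp
  qed
  finally have L: "?L = (if k < l then indicator A ((\<theta> ^^ (l - k)) x) else 0)" .
  define b where "b = atom (n + l) x"
  have b: "x \<in> b" "b \<in> \<alpha>'" "\<And>a. a \<in> \<alpha>' \<Longrightarrow> x \<in> a \<Longrightarrow> a = b"
    using in_induced_partition_iff[of x] x by (auto simp: b_def)
  have Nb: "Na b = l" using set_hit_time[OF b(2,1)] x by simp
  have "?R = (\<Sum>a\<in>{b}. indicator {a. k < Na a} a * indicator (a \<inter> (\<theta> ^^ (Na a - k)) -` A) x)"
  proof (rule nn_integral_count_space')
    fix a assume "a \<in> \<alpha>'" "a \<notin> {b}"
    hence "x \<notin> a" using b(3) by blast
    thus "indicator {a. k < Na a} a * indicator (a \<inter> (\<theta> ^^ (Na a - k)) -` A) x = (0 :: ennreal)" by simp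
  qed (use b(2) in auto)
  thus ?thesis using L b(1) Nb by (simp add: indicator_def)
qed

lemma emeasure_nu_tower:
  assumes A: "A \<in> sets borel" and entry: "\<And>x. x \<in> A \<Longrightarrow> entry_time \<theta> B x k"
  shows "emeasure \<nu> A =
    (\<integral>\<^sup>+a. indicator {a. k < Na a} a * emeasure \<nu> (a \<inter> (\<theta> ^^ (Na a - k)) -` A) \<partial>count_space \<alpha>')"
proof (cases "k = 0")
  \<comment> \<open>Here \<open>A\<close> lies in \<open>B\<close>, and the right side counts visits
    at the time of return, while the tower counts those at time 0. Invariance of
    \<open>\<nu>'\<close> equates the two.\<close>
  case True
  have AB: "A \<subseteq> B" using entry True by auto
  note vim = nu'_vimage[OF A AB]
  have pos: "0 < Na a" if "a \<in> \<alpha>'" for a using induced_partitionE[OF that] by force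
  \<comment> \<open>The induced partition covers only the points of \<open>B\<close> that return.
    The others are fixed by \<open>hit_map\<close> and have to be removed; they form a null
    set.\<close>
  have union: "(\<Union>a\<in>\<alpha>'. a \<inter> (\<theta> ^^ Na a) -` A) = (B \<inter> hit_map \<theta> B -` A) - never_hit"
  proof (intro equalityI subsetI)
    fix x assume "x \<in> (\<Union>a\<in>\<alpha>'. a \<inter> (\<theta> ^^ Na a) -` A)"
    thus "x \<in> (B \<inter> hit_map \<theta> B -` A) - never_hit"
      using induced_subset hit_map_induced set_hit_time by (fastforce simp: never_hit_def)
  next
    fix x assume x: "x \<in> (B \<inter> hit_map \<theta> B -` A) - never_hit"
    then obtain l where "N x = enat l" by (auto simp: never_hit_def)
    hence b: "x \<in> atom (n + l) x" "atom (n + l) x \<in> \<alpha>'" using x in_induced_partition_iff[of x] by auto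
    thus "x \<in> (\<Union>a\<in>\<alpha>'. a \<inter> (\<theta> ^^ Na a) -` A)"
      using x hit_map_induced[OF b(2,1)] by (intro UN_I[OF b(2)]) auto
  qed
  have disjoint: "disjoint_family_on (\<lambda>a. a \<inter> (\<theta> ^^ Na a) -` A) \<alpha>'"
    unfolding disjoint_family_on_def
  proof (intro ballI impI, rule ccontr)
    fix a b assume ab: "a \<in> \<alpha>'" "b \<in> \<alpha>'" "a \<noteq> b"
      "a \<inter> (\<theta> ^^ Na a) -` A \<inter> (b \<inter> (\<theta> ^^ Na b) -` A) \<noteq> {}"
    then obtain x where "x \<in> a" "x \<in> b" by blast
    thus False using ab in_induced_partition_iff[of x a] in_induced_partition_iff[of x b] by auto
  qed
  have "emeasure \<nu> A = emeasure \<nu> ((B \<inter> hit_map \<theta> B -` A) - never_hit)"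
    using vim never_hit_null by (subst emeasure_Diff_null_set) (auto simp: null_sets_def nu_sets)
  also have "\<dots> = (\<integral>\<^sup>+a. emeasure \<nu> (a \<inter> (\<theta> ^^ Na a) -` A) \<partial>count_space \<alpha>')"
    unfolding union[symmetric]
    using disjoint countable_induced_partition A
    by (intro emeasure_UN_countable) (auto simp: nu_sets branch_cylinder_borel)
  also have "\<dots> = (\<integral>\<^sup>+a. indicator {a. k < Na a} a * emeasure \<nu> (a \<inter> (\<theta> ^^ (Na a - k)) -` A) \<partial>count_space \<alpha>')"
    using pos True by (intro nn_integral_cong) simp
  finally show ?thesis .
next
  case False
  let ?X = "\<lambda>a. a \<inter> (\<theta> ^^ (Na a - k)) -` A"
  have X: "?X a \<in> sets borel" "?X a \<subseteq> B" if "a \<in> \<alpha>'" for a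
    using that A induced_subset by (auto simp: branch_cylinder_borel)
  have "emeasure \<nu> A = (\<integral>\<^sup>+ x. indicator A x \<partial>\<nu>)" using A
    by (simp add: nu_sets)
  also have "\<dots> = 1 / c * (\<integral>\<^sup>+ \<omega>. (\<Sum>\<^sub>\<infinity>k\<in>{k. enat k < N \<omega>}. indicator A ((\<theta> ^^ k) \<omega>)) \<partial>\<nu>')"
    unfolding c_def using A by (intro kac) simp
  also have "(\<integral>\<^sup>+ \<omega>. (\<Sum>\<^sub>\<infinity>k\<in>{k. enat k < N \<omega>}. indicator A ((\<theta> ^^ k) \<omega>) :: ennreal) \<partial>\<nu>') =
      (\<integral>\<^sup>+ x. \<integral>\<^sup>+a. indicator {a. k < Na a} a * indicator (?X a) x \<partial>count_space \<alpha>' \<partial>\<nu>')"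
  proof (rule nn_integral_cong_AE)
    show "AE x in \<nu>'. (\<Sum>\<^sub>\<infinity>j\<in>{j. enat j < N x}. indicator A ((\<theta> ^^ j) x) :: ennreal) =
        (\<integral>\<^sup>+a. indicator {a. k < Na a} a * indicator (?X a) x \<partial>count_space \<alpha>')"
      using AE_nu'_hit AE_space
    proof eventually_elim
      case (elim x)
      then obtain l where "x \<in> B" "N x = enat l" by (auto simp: space_nu')
      thus ?case using False entry by (intro sum_before_return) auto
    qed
  qed
  also have "\<dots> = (\<integral>\<^sup>+a. \<integral>\<^sup>+ x. indicator {a. k < Na a} a * indicator (?X a) x \<partial>\<nu>' \<partial>count_space \<alpha>')"
  proof (rule nn_integral_count_space_nn_integral[OF countable_induced_partition])
    fix a assume "a \<in> \<alpha>'"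
    hence "?X a \<in> sets \<nu>'" using X unfolding sets_nu' by blast
    thus "(\<lambda>x. indicator {a. k < Na a} a * indicator (?X a) x :: ennreal) \<in> borel_measurable \<nu>'"
      by (intro borel_measurable_times_ennreal borel_measurable_indicator) simp
  qed
  also have "\<dots> = (\<integral>\<^sup>+a. c * (indicator {a. k < Na a} a * emeasure \<nu> (?X a)) \<partial>count_space \<alpha>')"
  proof (rule nn_integral_cong)
    fix a assume "a \<in> space (count_space \<alpha>')"
    hence Xa: "?X a \<in> sets borel" "?X a \<subseteq> B" using X by auto
    hence "(\<integral>\<^sup>+ x. indicator {a. k < Na a} a * indicator (?X a) x \<partial>\<nu>') =
        indicator {a. k < Na a} a * emeasure \<nu>' (?X a)"
      by (intro nn_integral_cmult_indicator) (simp add: sets_nu')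
    thus "(\<integral>\<^sup>+ x. indicator {a. k < Na a} a * indicator (?X a) x \<partial>\<nu>') =
        c * (indicator {a. k < Na a} a * emeasure \<nu> (?X a))"
      by (simp only: emeasure_nu'_eq[OF Xa] mult.left_commute)
  qed
  also have "\<dots> = c * (\<integral>\<^sup>+a. indicator {a. k < Na a} a * emeasure \<nu> (?X a) \<partial>count_space \<alpha>')"
    by (rule nn_integral_cmult) simp
  finally show ?thesis by (simp only: mult_inverse_c)
qed

lemma nu'_null_iff: "A \<in> sets borel \<Longrightarrow> A \<subseteq> B \<Longrightarrow> emeasure \<nu>' A = 0 \<longleftrightarrow> emeasure m A = 0"
  using c_pos by (auto simp: emeasure_nu'_eq nu_null_iff)

lemma nn_integral_nu'_subset:
  assumes "(\<lambda>x. f x * indicator a x) \<in> borel_measurable borel" "D \<in> sets borel" "D \<subseteq> a" "a \<subseteq> B"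
  shows "(\<integral>\<^sup>+x\<in>D. f x \<partial>\<nu>') = c * (\<integral>\<^sup>+x\<in>D. f x \<partial>\<nu>)"
proof -
  have eq: "f x * indicator D x * indicator B x = f x * indicator D x"
    "f x * indicator D x = f x * indicator a x * indicator D x" for x
    using assms by (auto split: split_indicator)
  have "(\<lambda>x. f x * indicator D x) \<in> borel_measurable borel"
    unfolding eq(2) using assms by measurable
  thus ?thesis using nn_integral_nu'[of "\<lambda>x. f x * indicator D x"] by (simp only: eq(1))
qed

lemma c_mult_cancel: "c * x = c * y \<Longrightarrow> x = y"
  using mult_inverse_c by metis

lemma measurable_nu'_indicator:
  assumes "(\<lambda>x. f x * indicator D x) \<in> borel_measurable \<nu>'" "D \<in> sets \<nu>'"
  shows "(\<lambda>x. f x * indicator D x :: ennreal) \<in> borel_measurable borel"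
proof -
  have "sets \<nu>' = sets (restrict_space borel B)"
    unfolding sets_nu' by (subst sets_restrict_space_subsets) auto
  hence "(\<lambda>x. f x * indicator D x) \<in> borel_measurable (restrict_space borel B)"
    using assms(1) measurable_cong_sets by blast
  hence "(\<lambda>x. f x * indicator D x * indicator B x) \<in> borel_measurable borel"
    by (subst (asm) borel_measurable_restrict_space_iff_ennreal) auto
  moreover have "f x * indicator D x * indicator B x = f x * indicator D x" for x
    using assms(2) by (auto simp: sets_nu' split: split_indicator)
  ultimately show ?thesis by simp
qed

section \<open>Derivatives of the induced map and of its inverse branches\<close>

context
  fixes a assumes a: "a \<in> \<alpha>'"
begin

lemma hit_map_conditions:
  shows "finite_measure \<nu>'" "a \<in> sets \<nu>'" "inj_on (hit_map \<theta> B) a"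
    "\<And>A. A \<in> sets \<nu>' \<Longrightarrow> A \<subseteq> a \<Longrightarrow> hit_map \<theta> B ` A \<in> sets \<nu>'"
    "\<And>A. A \<in> sets \<nu>' \<Longrightarrow> A \<subseteq> a \<Longrightarrow> emeasure \<nu>' A = 0 \<Longrightarrow> emeasure \<nu>' (hit_map \<theta> B ` A) = 0"
proof -
  show "finite_measure \<nu>'" by (rule nu'.finite_measure_axioms)
  show "a \<in> sets \<nu>'" using a by (simp add: sets_nu' induced_borel induced_subset)
  show "inj_on (hit_map \<theta> B) a" by (rule inj_on_hit_map[OF a])
  show im: "hit_map \<theta> B ` A \<in> sets \<nu>'" if "A \<in> sets \<nu>'" "A \<subseteq> a" for A
    using that hit_map_image_borel[OF a] hit_map_image_subset[OF a] by (simp add: sets_nu')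
  show "emeasure \<nu>' (hit_map \<theta> B ` A) = 0" if A: "A \<in> sets \<nu>'" "A \<subseteq> a" "emeasure \<nu>' A = 0" for A
  proof -
    obtain x k where x: "a = atom (n + k) x" "Na a = k" using induced_partitionE[OF a] by metis
    \<comment> \<open>Forward images of null sets are controlled only for \<open>m\<close>, hence
      the passage through the equivalence of \<open>\<nu>'\<close> and \<open>m\<close> on
      \<open>B\<close>.\<close>
    have "emeasure m A = 0" using A by (simp add: nu'_null_iff sets_nu')
    hence "emeasure m ((\<theta> ^^ Na a) ` A) = 0"
      using image_null_iff[of A "n + k" x k] A x by (simp add: sets_nu')
    thus ?thesis using im[OF A(1,2)] A by (simp add: nu'_null_iff sets_nu' hit_map_image[OF a])
  qed
qed

lemma inverse_branch_conditions:
  shows "hit_map \<theta> B ` a \<in> sets \<nu>'" "inj_on (inverse_branch \<theta> B a) (hit_map \<theta> B ` a)"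
    "\<And>A. A \<in> sets \<nu>' \<Longrightarrow> A \<subseteq> hit_map \<theta> B ` a \<Longrightarrow> inverse_branch \<theta> B a ` A \<in> sets \<nu>'"
    "\<And>A. A \<in> sets \<nu>' \<Longrightarrow> A \<subseteq> hit_map \<theta> B ` a \<Longrightarrow> emeasure \<nu>' A = 0 \<Longrightarrow>
      emeasure \<nu>' (inverse_branch \<theta> B a ` A) = 0"
proof -
  show "hit_map \<theta> B ` a \<in> sets \<nu>'" using hit_map_conditions by blast
  show "inj_on (inverse_branch \<theta> B a) (hit_map \<theta> B ` a)"
    by (rule inj_on_inverse_branch[OF a])
  show im: "inverse_branch \<theta> B a ` A \<in> sets \<nu>'" if "A \<in> sets \<nu>'" "A \<subseteq> hit_map \<theta> B ` a" for A
    using that branch_cylinder_borel[OF a] induced_subset[OF a]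
    by (auto simp: sets_nu' inverse_branch_image[OF a])
  show "emeasure \<nu>' (inverse_branch \<theta> B a ` A) = 0"
    if A: "A \<in> sets \<nu>'" "A \<subseteq> hit_map \<theta> B ` a" "emeasure \<nu>' A = 0" for A
  proof -
    have AB: "A \<in> sets borel" "A \<subseteq> B" using A by (auto simp: sets_nu')
    \<comment> \<open>For inverse branches nullity comes from invariance instead: the image is part
      of a full preimage under the induced map.\<close>
    have sub: "inverse_branch \<theta> B a ` A \<subseteq> B \<inter> hit_map \<theta> B -` A"
      unfolding inverse_branch_image[OF a A(2)] using induced_subset[OF a] hit_map_induced[OF a] by auto
    have "emeasure \<nu> A = 0" using A(3) c_pos by (auto simp: emeasure_nu'_eq[OF AB])
    hence "emeasure \<nu> (B \<inter> hit_map \<theta> B -` A) = 0" using nu'_vimage[OF AB] by simp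
    hence "emeasure \<nu>' (B \<inter> hit_map \<theta> B -` A) = 0"
      using nu'_vimage(1)[OF AB] by (subst emeasure_nu'_eq) auto
    thus ?thesis
      using emeasure_mono[OF sub, of \<nu>'] nu'_vimage(1)[OF AB] by (simp add: sets_nu')
  qed
qed

lemma branch_deriv_measurable:
  "(\<lambda>x. branch_deriv \<nu>' \<theta> B a x * indicator (hit_map \<theta> B ` a) x) \<in> borel_measurable borel"
  unfolding branch_deriv_def
  using inverse_branch_conditions hit_map_conditions(1)
  by (intro measurable_nu'_indicator deriv_on_measurable) blast+

text \<open>The derivative is formed with \<open>\<nu>'\<close> and the integral with
  \<open>\<nu>\<close>. On \<open>B\<close> the two measures differ by the factor \<open>c\<close>,
  which occurs on both sides and cancels because it is positive and finite.\<close>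

lemma nn_integral_branch_deriv:
  assumes D: "D \<in> sets borel" "D \<subseteq> hit_map \<theta> B ` a"
  shows "(\<integral>\<^sup>+x\<in>D. branch_deriv \<nu>' \<theta> B a x \<partial>\<nu>) = emeasure \<nu> (a \<inter> (\<theta> ^^ Na a) -` D)"
proof (rule c_mult_cancel)
  note conds = inverse_branch_conditions
  have DB: "D \<subseteq> B" using D hit_map_image_subset[OF a order_refl] by blast
  have "c * (\<integral>\<^sup>+x\<in>D. branch_deriv \<nu>' \<theta> B a x \<partial>\<nu>) = (\<integral>\<^sup>+x\<in>D. branch_deriv \<nu>' \<theta> B a x \<partial>\<nu>')"
    using nn_integral_nu'_subset[OF branch_deriv_measurable D hit_map_image_subset[OF a order_refl]] by simp
  also have "\<dots> = emeasure \<nu>' (inverse_branch \<theta> B a ` D)"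
    unfolding branch_deriv_def
    by (rule nn_integral_deriv_on[OF hit_map_conditions(1) conds]) (use D DB in \<open>simp_all add: sets_nu'\<close>)
  also have "\<dots> = c * emeasure \<nu> (inverse_branch \<theta> B a ` D)"
    using conds(3)[of D] D DB by (intro emeasure_nu'_eq) (auto simp: sets_nu')
  finally show "c * (\<integral>\<^sup>+x\<in>D. branch_deriv \<nu>' \<theta> B a x \<partial>\<nu>) = c * emeasure \<nu> (a \<inter> (\<theta> ^^ Na a) -` D)"
    by (simp add: inverse_branch_image[OF a D(2)])
qed

lemma induced_deriv_measurable:
  "(\<lambda>x. deriv_on \<nu>' (hit_map \<theta> B) a x * indicator a x) \<in> borel_measurable borel"
  using hit_map_conditions by (intro measurable_nu'_indicator deriv_on_measurable) blast+

lemma nn_integral_induced_deriv: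
  assumes A: "A \<in> sets borel" "A \<subseteq> a"
  shows "(\<integral>\<^sup>+x\<in>A. deriv_on \<nu>' (hit_map \<theta> B) a x \<partial>\<nu>) = emeasure \<nu> ((\<theta> ^^ Na a) ` A)"
proof (rule c_mult_cancel)
  have AB: "A \<subseteq> B" using A induced_subset[OF a] by blast
  have "c * (\<integral>\<^sup>+x\<in>A. deriv_on \<nu>' (hit_map \<theta> B) a x \<partial>\<nu>) = (\<integral>\<^sup>+x\<in>A. deriv_on \<nu>' (hit_map \<theta> B) a x \<partial>\<nu>')"
    using nn_integral_nu'_subset[OF induced_deriv_measurable A induced_subset[OF a]] by simp
  also have "\<dots> = emeasure \<nu>' (hit_map \<theta> B ` A)"
    by (rule nn_integral_deriv_on[OF hit_map_conditions]) (use A AB in \<open>simp_all add: sets_nu'\<close>)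
  also have "\<dots> = c * emeasure \<nu> (hit_map \<theta> B ` A)"
    using hit_map_image_borel[OF a] hit_map_image_subset[OF a] A by (intro emeasure_nu'_eq) auto
  finally show "c * (\<integral>\<^sup>+x\<in>A. deriv_on \<nu>' (hit_map \<theta> B) a x \<partial>\<nu>) = c * emeasure \<nu> ((\<theta> ^^ Na a) ` A)"
    using A by (simp add: hit_map_image[OF a])
qed

end

text \<open>The point \<open>x\<close> that selects the branches is kept apart from the point
  \<open>y\<close> of evaluation. Since \<open>x\<close> matters only through its cylinder of length
  \<open>n + k\<close>, fixing it leaves a single function of \<open>y\<close> that can be
  integrated over the image in \<open>B\<close>.\<close>

definition branch_sum :: "nat \<Rightarrow> 'a \<Rightarrow> 'a \<Rightarrow> ennreal" where
  "branch_sum k x y = (\<Sum>\<^sub>\<infinity>a\<in>preimage_branches k x. branch_deriv \<nu>' \<theta> B a y)"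

lemma preimage_branchesD: "a \<in> preimage_branches k x \<Longrightarrow> a \<in> \<alpha>'"
  by (simp add: preimage_branches_def)

lemma countable_preimage_branches: "countable (preimage_branches k x)"
  using countable_induced_partition preimage_branchesD by (auto intro: countable_subset)

lemma branch_deriv_measurable_subset:
  assumes a: "a \<in> \<alpha>'" and D: "D \<in> sets borel" "D \<subseteq> hit_map \<theta> B ` a"
  shows "(\<lambda>y. branch_deriv \<nu>' \<theta> B a y * indicator D y) \<in> borel_measurable borel"
proof -
  have "branch_deriv \<nu>' \<theta> B a y * indicator D y =
      branch_deriv \<nu>' \<theta> B a y * indicator (hit_map \<theta> B ` a) y * indicator D y" for y
    using D by (auto split: split_indicator)
  moreover have "(\<lambda>y. branch_deriv \<nu>' \<theta> B a y * indicator (hit_map \<theta> B ` a) y * indicator D y) \<in> borel_measurable borel"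
    by (intro borel_measurable_times_ennreal branch_deriv_measurable a borel_measurable_indicator D)
  ultimately show ?thesis by simp
qed

lemma branch_sum_mult_indicator:
  "branch_sum k x y * indicator D y =
    (\<Sum>\<^sub>\<infinity>a\<in>preimage_branches k x. branch_deriv \<nu>' \<theta> B a y * indicator D y)"
  by (cases "y \<in> D") (simp_all add: branch_sum_def)

lemma branch_sum_measurable:
  assumes "D \<in> sets borel" "D \<subseteq> (\<theta> ^^ k) ` atom (n + k) x"
  shows "(\<lambda>y. branch_sum k x y * indicator D y) \<in> borel_measurable borel"
  unfolding branch_sum_mult_indicator
proof (rule borel_measurable_infsum_ennreal[OF countable_preimage_branches])
  fix a assume a: "a \<in> preimage_branches k x"
  show "(\<lambda>y. branch_deriv \<nu>' \<theta> B a y * indicator D y) \<in> borel_measurable borel"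
    using preimage_branch_vimage(2)[OF a order_refl] assms
    by (intro branch_deriv_measurable_subset preimage_branchesD[OF a]) auto
qed

lemma emeasure_nu_branch_sum:
  assumes A: "A \<in> sets borel" "A \<subseteq> atom (n + k) x" and x: "entry_time \<theta> B x k"
  shows "emeasure \<nu> A = (\<integral>\<^sup>+y\<in>(\<theta> ^^ k) ` A. branch_sum k x y \<partial>\<nu>)"
proof -
  let ?Z = "preimage_branches k x"
  have D: "(\<theta> ^^ k) ` A \<in> sets borel" using image_borel[OF A(2,1)] by simp
  have "emeasure \<nu> A =
      (\<integral>\<^sup>+a. indicator {a. k < Na a} a * emeasure \<nu> (a \<inter> (\<theta> ^^ (Na a - k)) -` A) \<partial>count_space \<alpha>')"
  proof (rule emeasure_nu_tower[OF A(1)])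
    show "entry_time \<theta> B y k" if "y \<in> A" for y
      using that A(2) entry_time_atom[of y k x] x by blast
  qed
  also have "\<dots> = (\<integral>\<^sup>+a. indicator {a. k < Na a} a * emeasure \<nu> (a \<inter> (\<theta> ^^ (Na a - k)) -` A) \<partial>count_space ?Z)"
  proof (rule nn_integral_count_space_eq)
    fix a assume a: "a \<in> \<alpha>' - ?Z"
    show "indicator {a. k < Na a} a * emeasure \<nu> (a \<inter> (\<theta> ^^ (Na a - k)) -` A) = 0"
      using not_preimage_branch_vimage[OF _ _ _ A(2), of a] a by (auto simp: indicator_def)
  qed (use preimage_branchesD in auto)
  also have "\<dots> = (\<integral>\<^sup>+a. \<integral>\<^sup>+y. branch_deriv \<nu>' \<theta> B a y * indicator ((\<theta> ^^ k) ` A) y \<partial>\<nu> \<partial>count_space ?Z)"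
  proof (rule nn_integral_cong)
    fix a assume "a \<in> space (count_space ?Z)"
    hence a: "a \<in> ?Z" by simp
    have "indicator {a. k < Na a} a * emeasure \<nu> (a \<inter> (\<theta> ^^ (Na a - k)) -` A) =
        emeasure \<nu> (a \<inter> (\<theta> ^^ Na a) -` (\<theta> ^^ k) ` A)"
      using a preimage_branch_vimage(1)[OF a A(2)] by (simp add: preimage_branches_def)
    thus "indicator {a. k < Na a} a * emeasure \<nu> (a \<inter> (\<theta> ^^ (Na a - k)) -` A) =
        (\<integral>\<^sup>+y. branch_deriv \<nu>' \<theta> B a y * indicator ((\<theta> ^^ k) ` A) y \<partial>\<nu>)"
      using nn_integral_branch_deriv[OF preimage_branchesD[OF a] D preimage_branch_vimage(2)[OF a A(2)]] by simp
  qed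
  also have "\<dots> = (\<integral>\<^sup>+y. \<integral>\<^sup>+a. branch_deriv \<nu>' \<theta> B a y * indicator ((\<theta> ^^ k) ` A) y \<partial>count_space ?Z \<partial>\<nu>)"
  proof (rule nn_integral_count_space_nn_integral[OF countable_preimage_branches, symmetric])
    fix a assume a: "a \<in> ?Z"
    show "(\<lambda>y. branch_deriv \<nu>' \<theta> B a y * indicator ((\<theta> ^^ k) ` A) y) \<in> borel_measurable \<nu>"
      unfolding measurable_cong_sets[OF nu_sets refl]
      by (rule branch_deriv_measurable_subset[OF preimage_branchesD[OF a] D preimage_branch_vimage(2)[OF a A(2)]])
  qed
  also have "\<dots> = (\<integral>\<^sup>+y\<in>(\<theta> ^^ k) ` A. branch_sum k x y \<partial>\<nu>)"
    by (simp only: branch_sum_mult_indicator infsum_eq_nn_integral_count_space[OF countable_preimage_branches])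
  finally show ?thesis .
qed

text \<open>Uniqueness of densities reduces a pointwise formula to the measures of the images of
  subsets of one cylinder. The derivative is computed on elements of \<open>\<alpha>\<close>, and
  \<open>1 \<le> L\<close> places the cylinder inside one of them.\<close>

lemma AE_jacobian_eq:
  assumes G: "(\<lambda>y. G y * indicator (atom L x) y) \<in> borel_measurable borel" and L: "1 \<le> L"
    and int: "\<And>A. A \<in> sets borel \<Longrightarrow> A \<subseteq> atom L x \<Longrightarrow> (\<integral>\<^sup>+y\<in>A. G y \<partial>\<nu>) = emeasure \<nu> (\<theta> ` A)"
  shows "AE y in \<nu>. y \<in> atom L x \<longrightarrow> measure_jacobian \<nu> \<alpha> \<theta> y = G y"
proof -
  have part: "part x \<in> sets borel" using part_in partition_measurable by auto
  have sub: "atom L x \<subseteq> part x" using L by (auto simp: atom_def in_part_iff dest: spec[of _ 0])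
  have conds: "finite_measure \<nu>" "part x \<in> sets \<nu>" "inj_on \<theta> (part x)"
    "\<And>A. A \<in> sets \<nu> \<Longrightarrow> A \<subseteq> part x \<Longrightarrow> \<theta> ` A \<in> sets \<nu>"
    "\<And>A. A \<in> sets \<nu> \<Longrightarrow> A \<subseteq> part x \<Longrightarrow> emeasure \<nu> A = 0 \<Longrightarrow> emeasure \<nu> (\<theta> ` A) = 0"
    using nu.finite_measure_axioms part invertible[OF part_in] image_measurable[OF part_in]
      branch_nonsingular[OF part_in] by (simp_all add: nu_sets nu_null_iff)
  have atom: "atom L x \<in> sets \<nu>" by (simp add: nu_sets)
  have "AE y in \<nu>. y \<in> atom L x \<longrightarrow> deriv_on \<nu> \<theta> (part x) y = G y"
  proof (rule AE_eq_on_if_nn_integral_eq[OF conds(1)])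
    have "(\<lambda>y. deriv_on \<nu> \<theta> (part x) y * indicator (part x) y * indicator (atom L x) y) \<in> borel_measurable \<nu>"
      using deriv_on_measurable[OF conds] borel_measurable_indicator[OF atom]
        by (rule borel_measurable_times_ennreal)
    moreover have "deriv_on \<nu> \<theta> (part x) y * indicator (part x) y * indicator (atom L x) y =
        deriv_on \<nu> \<theta> (part x) y * indicator (atom L x) y" for y
      using sub by (auto split: split_indicator)
    ultimately show "(\<lambda>y. deriv_on \<nu> \<theta> (part x) y * indicator (atom L x) y) \<in> borel_measurable \<nu>"
      by simp
    show "(\<lambda>y. G y * indicator (atom L x) y) \<in> borel_measurable \<nu>"
      using G by (simp add: measurable_cong_sets[OF nu_sets refl])
    show "(\<integral>\<^sup>+y\<in>A. deriv_on \<nu> \<theta> (part x) y \<partial>\<nu>) = (\<integral>\<^sup>+y\<in>A. G y \<partial>\<nu>)"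
      if A: "A \<in> sets \<nu>" "A \<subseteq> atom L x" for A
    proof -
      have "(\<integral>\<^sup>+y\<in>A. deriv_on \<nu> \<theta> (part x) y \<partial>\<nu>) = emeasure \<nu> (\<theta> ` A)"
        using A sub by (intro nn_integral_deriv_on[OF conds]) auto
      thus ?thesis using int[of A] A by (simp add: nu_sets)
    qed
  qed (simp add: nu_sets)
  thus ?thesis
  proof (rule AE_mp, intro AE_I2 impI)
    fix y assume y: "y \<in> atom L x \<longrightarrow> deriv_on \<nu> \<theta> (part x) y = G y" "y \<in> atom L x"
    have "measure_jacobian \<nu> \<alpha> \<theta> y = deriv_on \<nu> \<theta> (part x) y"
    proof (rule measure_jacobian_eq[OF part_in])
      show yx: "y \<in> part x" using y(2) sub by blast
      show "b = part x" if "b \<in> \<alpha>" "y \<in> b" for b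
        using part_eqI[OF that] yx by (simp add: in_part_iff)
    qed
    thus "measure_jacobian \<nu> \<alpha> \<theta> y = G y" using y by simp
  qed
qed

text \<open>The exceptional null sets can be collected because there are only countably many
  cylinders. In each cylinder that meets \<open>Q\<close>, any point with \<open>Q\<close> serves as
  representative.\<close>

lemma AE_atoms:
  assumes "\<And>x. Q x \<Longrightarrow> AE y in \<nu>. y \<in> atom L x \<longrightarrow> P y"
  shows "AE y in \<nu>. Q y \<longrightarrow> P y"
proof -
  have "AE y in \<nu>. \<forall>C\<in>range (atom L). y \<in> C \<longrightarrow> Q y \<longrightarrow> P y"
  proof (subst AE_ball_countable[OF countable_cylinders], rule ballI)
    fix C assume C: "C \<in> range (atom L)"
    show "AE y in \<nu>. y \<in> C \<longrightarrow> Q y \<longrightarrow> P y"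
    proof (cases "\<exists>x\<in>C. Q x")
      case True
      then obtain x where x: "x \<in> C" "Q x" by blast
      hence "C = atom L x" using C atom_eq by fastforce
      thus ?thesis using assms[OF x(2)] by (auto elim: AE_mp)
    qed (simp add: AE_I2)
  qed
  thus ?thesis
  proof (rule AE_mp, intro AE_I2 impI)
    fix y assume "\<forall>C\<in>range (atom L). y \<in> C \<longrightarrow> Q y \<longrightarrow> P y" "Q y"
    thus "P y" using in_atom_self[of y L] by blast
  qed
qed

section \<open>The two formulas on one cylinder\<close>

lemma image_vimage_Int: "f ` (A \<inter> f -` D) = f ` A \<inter> D"
  by blast

lemma nn_integral_image_branch_sum:
  assumes A: "A \<in> sets borel" "A \<subseteq> atom (n + Suc k) x" and x: "entry_time \<theta> B (\<theta> x) k"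
  shows "(\<integral>\<^sup>+y\<in>(\<theta> ^^ Suc k) ` A. branch_sum k (\<theta> x) y \<partial>\<nu>) = emeasure \<nu> (\<theta> ` A)"
proof -
  have "\<theta> ` A \<subseteq> atom (n + k) (\<theta> x)"
    using A(2) image_atom_Suc[of "n + k" x] n_pos by auto
  moreover have "\<theta> ` A \<in> sets borel" using image_borel[OF A(2,1), of 1] by simp
  ultimately have "emeasure \<nu> (\<theta> ` A) = (\<integral>\<^sup>+y\<in>(\<theta> ^^ k) ` \<theta> ` A. branch_sum k (\<theta> x) y \<partial>\<nu>)"
    using x by (intro emeasure_nu_branch_sum)
  moreover have "(\<theta> ^^ k) ` \<theta> ` A = (\<theta> ^^ Suc k) ` A"
    unfolding image_comp funpow_Suc_right ..
  ultimately show ?thesis by simp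
qed

lemma image_branch_sum_measurable:
  assumes D: "D \<in> sets borel" "D \<subseteq> (\<theta> ^^ Suc k) ` atom (n + Suc k) x"
  shows "(\<lambda>y. branch_sum k (\<theta> x) y * indicator D y) \<in> borel_measurable borel"
proof (rule branch_sum_measurable)
  have "(\<theta> ^^ Suc k) ` atom (n + Suc k) x = (\<theta> ^^ k) ` \<theta> ` atom (n + Suc k) x"
    unfolding image_comp funpow_Suc_right ..
  thus "D \<subseteq> (\<theta> ^^ k) ` atom (n + k) (\<theta> x)"
    using D image_atom_Suc[of "n + k" x] n_pos by simp
qed fact

lemma jacobian_inside:
  assumes x: "x \<in> B" "N x = enat (Suc k)"
  shows "AE y in \<nu>. y \<in> atom (n + Suc k) x \<longrightarrow>
    measure_jacobian \<nu> \<alpha> \<theta> y =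
      branch_sum k (\<theta> y) ((\<theta> ^^ Suc k) y) * measure_jacobian \<nu>' \<alpha>' (hit_map \<theta> B) y"
proof -
  let ?l = "Suc k" let ?C = "atom (n + ?l) x"
  let ?T = "\<theta> ^^ ?l" let ?J = "deriv_on \<nu>' (hit_map \<theta> B) ?C" let ?S = "branch_sum k (\<theta> x)"
  define E where "E = ?T ` ?C"
  have C: "?C \<in> \<alpha>'" using in_induced_partition_iff[of x] x by blast
  have "N x = enat (Na ?C)" by (rule set_hit_time[OF C in_atom_self])
  hence NC: "Na ?C = ?l" by (simp only: x(2) enat.inject)
  have E: "E \<in> sets borel" unfolding E_def by (rule image_borel[OF order_refl]) auto
  have entry: "entry_time \<theta> B (\<theta> x) k" by (rule entry_time_image[OF x(2)])
  \<comment> \<open>The branch sum is known to be measurable only on the image \<open>E\<close> of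
    the cylinder, so it is cut off there; \<open>h\<close> is evaluated at points of
    \<open>E\<close> only, wherever its value counts.\<close>
  define h where "h y = ?S y * indicator E y" for y
  have h: "h \<in> borel_measurable borel"
    unfolding h_def using E by (intro image_branch_sum_measurable) (auto simp: E_def)
  have TE: "?T y \<in> E" if "y \<in> ?C" for y using that by (auto simp: E_def)
  have J: "(\<lambda>y. ?J y * indicator A y) \<in> borel_measurable borel" if "A \<in> sets borel" "A \<subseteq> ?C" for A
  proof -
    have "(\<lambda>y. ?J y * indicator ?C y * indicator A y) \<in> borel_measurable borel"
      by (rule borel_measurable_times_ennreal[OF induced_deriv_measurable[OF C] borel_measurable_indicator]) fact
    moreover have "?J y * indicator ?C y * indicator A y = ?J y * indicator A y" for y
      using that by (auto split: split_indicator)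
    ultimately show ?thesis by simp
  qed
  have "AE y in \<nu>. y \<in> ?C \<longrightarrow> measure_jacobian \<nu> \<alpha> \<theta> y = h (?T y) * ?J y"
  proof (rule AE_jacobian_eq)
    show "(\<lambda>y. h (?T y) * ?J y * indicator ?C y) \<in> borel_measurable borel"
      unfolding mult.assoc
      by (intro borel_measurable_times_ennreal measurable_compose[OF measurable_funpow h] J) auto
    fix A assume A: "A \<in> sets borel" "A \<subseteq> ?C"
    have TA: "?T ` A \<in> sets borel" using image_borel[OF A(2,1), of ?l] by simp
    have "(\<integral>\<^sup>+y\<in>A. h (?T y) * ?J y \<partial>\<nu>) = (\<integral>\<^sup>+y. ?J y * indicator A y * h (?T y) \<partial>\<nu>)"
      by (simp only: ac_simps)
    \<comment> \<open>The derivative \<open>?J\<close> is the weight that makes the push-forward of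
      \<open>\<nu>\<close> from \<open>A\<close> equal to \<open>\<nu>\<close> on the image of
      \<open>A\<close>.\<close>
    also have "\<dots> = (\<integral>\<^sup>+y. indicator (?T ` A) y * h y \<partial>\<nu>)"
    proof (rule nn_integral_change_of_variables[OF _ _ _ _ nu_sets _ h])
      fix D :: "'a set" assume D: "D \<in> sets borel"
      have "(\<integral>\<^sup>+y. ?J y * indicator A y * indicator D (?T y) \<partial>\<nu>) = (\<integral>\<^sup>+y\<in>A \<inter> ?T -` D. ?J y \<partial>\<nu>)"
        by (intro nn_integral_cong) (auto split: split_indicator)
      also have "\<dots> = emeasure \<nu> (?T ` (A \<inter> ?T -` D))"
        using nn_integral_induced_deriv[OF C, of "A \<inter> ?T -` D"] A D funpow_vimage_borel[of D ?l] unfolding NC by auto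
      also have "\<dots> = (\<integral>\<^sup>+y. indicator (?T ` A \<inter> D) y \<partial>\<nu>)"
        using TA D unfolding image_vimage_Int by (simp add: nu_sets)
      also have "\<dots> = (\<integral>\<^sup>+y. indicator (?T ` A) y * indicator D y \<partial>\<nu>)"
        by (intro nn_integral_cong) (auto split: split_indicator)
      finally show "(\<integral>\<^sup>+y. ?J y * indicator A y * indicator D (?T y) \<partial>\<nu>) =
          (\<integral>\<^sup>+y. indicator (?T ` A) y * indicator D y \<partial>\<nu>)" .
    qed (use A TA J[OF A] measurable_funpow[of ?l] in
        \<open>simp_all add: nu_sets measurable_cong_sets[OF nu_sets refl] del: funpow.simps\<close>)
    also have "\<dots> = (\<integral>\<^sup>+y\<in>?T ` A. ?S y \<partial>\<nu>)"
      using A TE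
        by (intro nn_integral_cong) (auto simp: h_def simp del: funpow.simps split: split_indicator)
    also have "\<dots> = emeasure \<nu> (\<theta> ` A)"
      by (rule nn_integral_image_branch_sum[OF A entry])
    finally show "(\<integral>\<^sup>+y\<in>A. h (?T y) * ?J y \<partial>\<nu>) = emeasure \<nu> (\<theta> ` A)" .
  qed (use n_pos in simp)
  thus ?thesis
  proof (rule AE_mp, intro AE_I2 impI)
    fix y assume y: "y \<in> ?C \<longrightarrow> measure_jacobian \<nu> \<alpha> \<theta> y = h (?T y) * ?J y" "y \<in> ?C"
    have "measure_jacobian \<nu>' \<alpha>' (hit_map \<theta> B) y = ?J y"
    proof (rule measure_jacobian_eq[OF C y(2)])
      fix b assume "b \<in> \<alpha>'" "y \<in> b"
      then obtain i where "N y = enat i" "b = atom (n + i) y" using in_induced_partition_iff[of y b] by blast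
      moreover obtain j where "N y = enat j" "?C = atom (n + j) y" using in_induced_partition_iff[of y ?C] C y(2) by blast
      ultimately show "b = ?C" by simp
    qed
    \<comment> \<open>The representative \<open>x\<close> was fixed in order to integrate. The
      constancy of the index set on cylinders now replaces it by \<open>y\<close>.\<close>
    moreover have "\<theta> y \<in> atom (n + k) (\<theta> x)" using y(2) by (simp add: in_atom_Suc)
    hence "branch_sum k (\<theta> y) = ?S"
      using preimage_branches_cong unfolding branch_sum_def fun_eq_iff by metis
    ultimately show "measure_jacobian \<nu> \<alpha> \<theta> y =
        branch_sum k (\<theta> y) (?T y) * measure_jacobian \<nu>' \<alpha>' (hit_map \<theta> B) y"
      using y TE[OF y(2)] by (simp add: h_def del: funpow.simps)
  qed
qed

text \<open>Finite because the integral over \<open>E\<close> is the finite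
  \<open>\<nu>\<close>-measure of the cylinder. Positive because the part of the cylinder lying over
  the zero set \<open>?Q\<close> has measure 0, and nonsingularity of \<open>\<theta> ^^ k\<close>
  on the cylinder carries this to \<open>?Q\<close>.\<close>

lemma AE_branch_sum_finite_pos:
  assumes x: "entry_time \<theta> B x k"
  defines "E \<equiv> (\<theta> ^^ k) ` atom (n + k) x"
  shows "AE y in \<nu>. y \<in> E \<longrightarrow> branch_sum k x y \<noteq> 0 \<and> branch_sum k x y \<noteq> \<infinity>"
proof -
  let ?T = "\<theta> ^^ k" let ?C = "atom (n + k) x" let ?S = "\<lambda>y. branch_sum k x y * indicator E y"
  have E: "E \<in> sets borel" unfolding E_def by (rule image_borel[OF order_refl]) auto
  have S: "?S \<in> borel_measurable borel"
    using E by (intro branch_sum_measurable) (auto simp: E_def)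
  have "emeasure \<nu> ?C = (\<integral>\<^sup>+y. ?S y \<partial>\<nu>)"
    unfolding E_def by (rule emeasure_nu_branch_sum[OF atom_borel order_refl x])
  hence "(\<integral>\<^sup>+y. ?S y \<partial>\<nu>) \<noteq> \<infinity>"
    using nu.emeasure_finite[of ?C] by simp
  hence "AE y in \<nu>. ?S y \<noteq> \<infinity>"
    using S by (intro nn_integral_noteq_infinite) (simp_all add: measurable_cong_sets[OF nu_sets refl])
  moreover have "AE y in \<nu>. y \<notin> E \<inter> {y. ?S y = 0}"
  proof -
    let ?Q = "E \<inter> {y. ?S y = 0}" let ?A = "?C \<inter> ?T -` ?Q"
    have "{y \<in> space borel. ?S y = 0} \<in> sets borel" using S by measurable
    hence Q: "?Q \<in> sets borel" using E by simp
    have A: "?A \<in> sets borel" "?A \<subseteq> ?C" using Q funpow_vimage_borel[of ?Q k] by auto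
    have TA: "?T ` ?A = ?Q" unfolding image_vimage_Int by (auto simp: E_def)
    have "emeasure \<nu> ?A = (\<integral>\<^sup>+y\<in>?Q. branch_sum k x y \<partial>\<nu>)"
      using emeasure_nu_branch_sum[OF A x] unfolding TA .
    also have "\<dots> = (\<integral>\<^sup>+y. 0 \<partial>\<nu>)"
      by (intro nn_integral_cong) (auto split: split_indicator)
    finally have "emeasure m ?A = 0" using A by (simp add: nu_null_iff)
    hence "emeasure m ?Q = 0" using image_null_iff[OF A(2,1), of k] TA by simp
    hence "emeasure \<nu> ?Q = 0" using Q by (simp add: nu_null_iff)
    thus ?thesis using Q by (intro AE_not_in) (simp add: null_sets_def nu_sets)
  qed
  ultimately show ?thesis by eventually_elim auto
qed

lemma jacobian_outside:
  assumes x: "x \<notin> B" "N x = enat (Suc k)"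
  shows "AE y in \<nu>. y \<in> atom (n + Suc k) x \<longrightarrow>
    measure_jacobian \<nu> \<alpha> \<theta> y =
      branch_sum k (\<theta> y) ((\<theta> ^^ Suc k) y) / branch_sum (Suc k) y ((\<theta> ^^ Suc k) y)"
proof -
  let ?l = "Suc k" let ?C = "atom (n + ?l) x" let ?T = "\<theta> ^^ ?l"
  let ?S1 = "branch_sum ?l x" let ?S2 = "branch_sum k (\<theta> x)"
  define E where "E = ?T ` ?C"
  have E: "E \<in> sets borel" unfolding E_def by (rule image_borel[OF order_refl]) auto
  have entry1: "entry_time \<theta> B x ?l" using x by (simp add: entry_time_outside)
  have entry2: "entry_time \<theta> B (\<theta> x) k" by (rule entry_time_image[OF x(2)])
  \<comment> \<open>Numerator and denominator are cut off separately to make the quotient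
    measurable. Its value outside \<open>E\<close> never enters.\<close>
  define h where "h y = (?S2 y * indicator E y) / (?S1 y * indicator E y)" for y
  have h: "h \<in> borel_measurable borel"
    unfolding h_def using E
    by (intro borel_measurable_divide_ennreal image_branch_sum_measurable branch_sum_measurable) (auto simp: E_def)
  have TE: "?T y \<in> E" if "y \<in> ?C" for y using that by (auto simp: E_def)
  have "AE y in \<nu>. y \<in> ?C \<longrightarrow> measure_jacobian \<nu> \<alpha> \<theta> y = h (?T y)"
  proof (rule AE_jacobian_eq)
    show "(\<lambda>y. h (?T y) * indicator ?C y) \<in> borel_measurable borel"
      by (intro borel_measurable_times_ennreal measurable_compose[OF measurable_funpow h]) auto
    fix A assume A: "A \<in> sets borel" "A \<subseteq> ?C"
    have TA: "?T ` A \<in> sets borel" using image_borel[OF A(2,1), of ?l] by simp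
    have TAE: "?T ` A \<subseteq> E" using A(2) unfolding E_def by (rule image_mono)
    have u: "(\<lambda>y. ?S1 y * indicator (?T ` A) y) \<in> borel_measurable borel"
      using TA TAE unfolding E_def by (rule branch_sum_measurable)
    have "(\<integral>\<^sup>+y\<in>A. h (?T y) \<partial>\<nu>) = (\<integral>\<^sup>+y. indicator A y * h (?T y) \<partial>\<nu>)"
      by (simp only: ac_simps)
    \<comment> \<open>Outside \<open>B\<close> the weight is on the other side: the push-forward of
      \<open>\<nu>\<close> from \<open>A\<close> has density \<open>?S1\<close> on the image of
      \<open>A\<close>.\<close>
    also have "\<dots> = (\<integral>\<^sup>+y. ?S1 y * indicator (?T ` A) y * h y \<partial>\<nu>)"
    proof (rule nn_integral_change_of_variables[OF _ _ _ _ nu_sets _ h])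
      fix D :: "'a set" assume D: "D \<in> sets borel"
      have AD: "A \<inter> ?T -` D \<in> sets borel" "A \<inter> ?T -` D \<subseteq> ?C"
        using A D funpow_vimage_borel[of D ?l] by auto
      have "(\<integral>\<^sup>+y. indicator A y * indicator D (?T y) \<partial>\<nu>) = (\<integral>\<^sup>+y. indicator (A \<inter> ?T -` D) y \<partial>\<nu>)"
        by (intro nn_integral_cong) (auto split: split_indicator)
      also have "\<dots> = emeasure \<nu> (A \<inter> ?T -` D)"
        using AD by (simp add: nu_sets)
      also have "\<dots> = (\<integral>\<^sup>+y\<in>?T ` A \<inter> D. ?S1 y \<partial>\<nu>)"
        using emeasure_nu_branch_sum[OF AD entry1] unfolding image_vimage_Int .
      also have "\<dots> = (\<integral>\<^sup>+y. ?S1 y * indicator (?T ` A) y * indicator D y \<partial>\<nu>)"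
        by (intro nn_integral_cong) (auto split: split_indicator)
      finally show "(\<integral>\<^sup>+y. indicator A y * indicator D (?T y) \<partial>\<nu>) =
          (\<integral>\<^sup>+y. ?S1 y * indicator (?T ` A) y * indicator D y \<partial>\<nu>)" .
    qed (use A u measurable_funpow[of ?l] in
        \<open>simp_all add: nu_sets measurable_cong_sets[OF nu_sets refl] del: funpow.simps\<close>)
    also have "\<dots> = (\<integral>\<^sup>+y\<in>?T ` A. ?S2 y \<partial>\<nu>)"
    proof (rule nn_integral_cong_AE)
      show "AE y in \<nu>. ?S1 y * indicator (?T ` A) y * h y = ?S2 y * indicator (?T ` A) y"
        using AE_branch_sum_finite_pos[OF entry1]
      proof eventually_elim
        case (elim y)
        show ?case
        proof (cases "y \<in> ?T ` A")
          case True
          hence "y \<in> E" using TAE by blast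
          moreover from this have "?S1 y \<noteq> 0" "?S1 y \<noteq> \<infinity>" using elim unfolding E_def by auto
          \<comment> \<open>In \<open>ennreal\<close> this cancellation can fail both at 0 and at
            infinity, since either makes the left side 0 or destroys the value of
            \<open>?S2 y\<close>; hence both exclusions.\<close>
          hence "?S1 y * (?S2 y / ?S1 y) = ?S2 y"
            by (simp add: ennreal_times_divide mult.commute[of "?S1 y"] ennreal_mult_divide_eq)
          ultimately show ?thesis using True by (simp add: h_def del: funpow.simps)
        qed simp
      qed
    qed
    also have "\<dots> = emeasure \<nu> (\<theta> ` A)"
      by (rule nn_integral_image_branch_sum[OF A entry2])
    finally show "(\<integral>\<^sup>+y\<in>A. h (?T y) \<partial>\<nu>) = emeasure \<nu> (\<theta> ` A)" .
  qed (use n_pos in simp)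
  thus ?thesis
  proof (rule AE_mp, intro AE_I2 impI)
    fix y assume y: "y \<in> ?C \<longrightarrow> measure_jacobian \<nu> \<alpha> \<theta> y = h (?T y)" "y \<in> ?C"
    have "\<theta> y \<in> atom (n + k) (\<theta> x)" using y(2) by (simp add: in_atom_Suc)
    hence "branch_sum k (\<theta> y) = ?S2" "branch_sum ?l y = ?S1"
      using preimage_branches_cong y(2) unfolding branch_sum_def fun_eq_iff by metis+
    thus "measure_jacobian \<nu> \<alpha> \<theta> y = branch_sum k (\<theta> y) (?T y) / branch_sum ?l y (?T y)"
      using y TE[OF y(2)] by (simp add: h_def del: funpow.simps)
  qed
qed

lemma Z_point_branch_sum:
  assumes "entry_time \<theta> B x k" "\<forall>j. N ((\<theta> ^^ j) x) \<noteq> \<infinity>"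
  shows "(\<Sum>\<^sub>\<infinity>a\<in>Z_point \<theta> \<alpha> B \<alpha>' x. branch_deriv \<nu>' \<theta> B a y) = branch_sum k x y"
  using assms(2)[rule_format, of 0] assms(2)[rule_format, of k]
  by (simp add: branch_sum_def Z_point_eq[OF assms(1)])

lemma jacobian_formulas:
  "(AE \<omega> in \<nu>. \<omega> \<in> B \<longrightarrow>
      measure_jacobian \<nu> \<alpha> \<theta> \<omega> =
        (\<Sum>\<^sub>\<infinity>a\<in>Z_point \<theta> \<alpha> B \<alpha>' (\<theta> \<omega>). branch_deriv \<nu>' \<theta> B a (hit_map \<theta> B \<omega>)) *
          measure_jacobian \<nu>' \<alpha>' (hit_map \<theta> B) \<omega>)
    \<and> (AE \<omega> in \<nu>. \<omega> \<notin> B \<longrightarrow>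
      measure_jacobian \<nu> \<alpha> \<theta> \<omega> =
        (\<Sum>\<^sub>\<infinity>a\<in>Z_point \<theta> \<alpha> B \<alpha>' (\<theta> \<omega>). branch_deriv \<nu>' \<theta> B a (hit_map \<theta> B \<omega>)) /
        (\<Sum>\<^sub>\<infinity>a\<in>Z_point \<theta> \<alpha> B \<alpha>' \<omega>. branch_deriv \<nu>' \<theta> B a (hit_map \<theta> B \<omega>)))"
proof
  have N_Suc: "\<exists>k. N x = enat (Suc k)" if hit: "\<forall>j. N ((\<theta> ^^ j) x) \<noteq> \<infinity>" for x
  proof -
    obtain l where l: "N x = enat l" using hit[rule_format, of 0] by auto
    hence "1 \<le> l" by (simp add: hit_time_eq_enat_iff)
    thus ?thesis using l by (cases l) auto
  qed
  have shift: "\<forall>j. N ((\<theta> ^^ j) (\<theta> x)) \<noteq> \<infinity>" if "\<forall>j. N ((\<theta> ^^ j) x) \<noteq> \<infinity>" for x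
    using that[rule_format, of "Suc _"] by (simp add: funpow_swap1)
  \<comment> \<open>The cylinder length depends on the hit time, so the gluing is done for each
    fixed \<open>k\<close>; countably many values of \<open>k\<close> cover almost every
    point.\<close>
  have "AE y in \<nu>. \<forall>k. y \<in> B \<and> N y = enat (Suc k) \<longrightarrow> measure_jacobian \<nu> \<alpha> \<theta> y =
      branch_sum k (\<theta> y) ((\<theta> ^^ Suc k) y) * measure_jacobian \<nu>' \<alpha>' (hit_map \<theta> B) y"
    by (subst AE_all_countable, rule allI, rule AE_atoms, rule jacobian_inside) auto
  with AE_nu_hit show "AE \<omega> in \<nu>. \<omega> \<in> B \<longrightarrow>
      measure_jacobian \<nu> \<alpha> \<theta> \<omega> =
        (\<Sum>\<^sub>\<infinity>a\<in>Z_point \<theta> \<alpha> B \<alpha>' (\<theta> \<omega>). branch_deriv \<nu>' \<theta> B a (hit_map \<theta> B \<omega>)) *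
          measure_jacobian \<nu>' \<alpha>' (hit_map \<theta> B) \<omega>"
  proof eventually_elim
    case (elim y)
    obtain k where k: "N y = enat (Suc k)" using N_Suc[OF elim(1)] by blast
    show ?case
      unfolding Z_point_branch_sum[OF entry_time_image[OF k] shift[OF elim(1)]] hit_map_eq[OF k]
      using elim(2) k by blast
  qed
  have "AE y in \<nu>. \<forall>k. y \<notin> B \<and> N y = enat (Suc k) \<longrightarrow> measure_jacobian \<nu> \<alpha> \<theta> y =
      branch_sum k (\<theta> y) ((\<theta> ^^ Suc k) y) / branch_sum (Suc k) y ((\<theta> ^^ Suc k) y)"
    by (subst AE_all_countable, rule allI, rule AE_atoms, rule jacobian_outside) auto
  with AE_nu_hit show "AE \<omega> in \<nu>. \<omega> \<notin> B \<longrightarrow>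
      measure_jacobian \<nu> \<alpha> \<theta> \<omega> =
        (\<Sum>\<^sub>\<infinity>a\<in>Z_point \<theta> \<alpha> B \<alpha>' (\<theta> \<omega>). branch_deriv \<nu>' \<theta> B a (hit_map \<theta> B \<omega>)) /
        (\<Sum>\<^sub>\<infinity>a\<in>Z_point \<theta> \<alpha> B \<alpha>' \<omega>. branch_deriv \<nu>' \<theta> B a (hit_map \<theta> B \<omega>))"
  proof eventually_elim
    case (elim y)
    obtain k where k: "N y = enat (Suc k)" using N_Suc[OF elim(1)] by blast
    show ?case
    proof
      assume y: "y \<notin> B"
      have "entry_time \<theta> B y (Suc k)" using y k by (simp add: entry_time_outside)
      thus "measure_jacobian \<nu> \<alpha> \<theta> y =
        (\<Sum>\<^sub>\<infinity>a\<in>Z_point \<theta> \<alpha> B \<alpha>' (\<theta> y). branch_deriv \<nu>' \<theta> B a (hit_map \<theta> B y)) /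
        (\<Sum>\<^sub>\<infinity>a\<in>Z_point \<theta> \<alpha> B \<alpha>' y. branch_deriv \<nu>' \<theta> B a (hit_map \<theta> B y))"
        unfolding Z_point_branch_sum[OF entry_time_image[OF k] shift[OF elim(1)]] hit_map_eq[OF k]
          Z_point_branch_sum[OF \<open>entry_time \<theta> B y (Suc k)\<close> elim(1)]
        using elim(2) k y by blast
    qed
  qed
qed

end

theorem proposition5p1:
  fixes m :: "'a::polish_space measure"
    and \<theta> :: "'a \<Rightarrow> 'a" and \<alpha> :: "'a set set" and B :: "'a set" and n :: nat
    and \<nu>' \<nu> :: "'a measure"
  defines "\<theta>' \<equiv> hit_map \<theta> B"
    and "N \<equiv> hit_time \<theta> B"
    and "\<alpha>' \<equiv> induced_partition \<theta> \<alpha> n B"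
    and "Z \<equiv> Z_point \<theta> \<alpha> B (induced_partition \<theta> \<alpha> n B)"
  assumes system: "markov_fibred_system m \<theta> \<alpha>" "conservative m \<theta>" "ergodic m \<theta>"
    and finite_partition: "finite \<alpha>"
    and B: "1 \<le> n" "B \<in> sigma_sets UNIV (cylinders \<theta> \<alpha> n)"
    and nu'_sets: "sets \<nu>' = sets (restrict_space m B)"
    and nu'_invariant: "invariant_measure \<nu>' \<theta>'"
    and nu'_ac: "absolutely_continuous (restrict_space m B) \<nu>'"
    and nu'_finite: "(\<integral>\<^sup>+ \<omega>. ennreal_of_enat (N \<omega>) \<partial>\<nu>') < \<infinity>"
    and nu_sets: "sets \<nu> = sets borel"
    and nu_prob: "prob_space \<nu>"
    and nu_invariant: "invariant_measure \<nu> \<theta>"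
    and kac: "\<And>f :: 'a \<Rightarrow> ennreal. f \<in> borel_measurable borel \<Longrightarrow>
      (\<integral>\<^sup>+ \<omega>. f \<omega> \<partial>\<nu>) =
        1 / (\<integral>\<^sup>+ \<omega>. ennreal_of_enat (N \<omega>) \<partial>\<nu>') *
        (\<integral>\<^sup>+ \<omega>. (\<Sum>\<^sub>\<infinity>k\<in>{k. enat k < N \<omega>}. f ((\<theta> ^^ k) \<omega>)) \<partial>\<nu>')"
  shows "(AE \<omega> in \<nu>. \<omega> \<in> B \<longrightarrow>
      measure_jacobian \<nu> \<alpha> \<theta> \<omega> =
        (\<Sum>\<^sub>\<infinity>a\<in>Z (\<theta> \<omega>). branch_deriv \<nu>' \<theta> B a (\<theta>' \<omega>)) * measure_jacobian \<nu>' \<alpha>' \<theta>' \<omega>)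
    \<and> (AE \<omega> in \<nu>. \<omega> \<notin> B \<longrightarrow>
      measure_jacobian \<nu> \<alpha> \<theta> \<omega> =
        (\<Sum>\<^sub>\<infinity>a\<in>Z (\<theta> \<omega>). branch_deriv \<nu>' \<theta> B a (\<theta>' \<omega>)) /
        (\<Sum>\<^sub>\<infinity>a\<in>Z \<omega>. branch_deriv \<nu>' \<theta> B a (\<theta>' \<omega>)))"
proof -
  interpret markov_fibred_system m \<theta> \<alpha> by (rule system)
  interpret kac_system m \<theta> \<alpha> B n \<nu>' \<nu>
    using B system nu'_sets nu'_invariant nu'_ac nu'_finite nu_sets nu_prob nu_invariant kac
    unfolding \<theta>'_def N_def
    by (intro kac_system.intro inducing_set.intro inducing_set_axioms.intro kac_system_axioms.intro)
  show ?thesis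
    unfolding \<theta>'_def \<alpha>'_def Z_def by (rule jacobian_formulas)
qed

end
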